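(* Let $S$ be the monoid given by the monoid presentation $$S=\langle a,b,x_n,y_n\ (n\in\mathbb{Z}) : abx_n=bx_n,\ aby_n=by_{n+1}\ (n\in\mathbb{Z})\rangle.$$ Then $S$ is left cancellative and strongly C$^*$-regular. It is not finitely aligned, and the groupoid $\mathcal{G}_P(S)=\mathcal{G}(S)$ is not Hausdorff.
   Context: Let $S$ be a left cancellative monoid with identity $e$. The left inverse hull $I_\ell(S)$ is the inverse semigroup of partial bijections of $S$ generated by the left translations $t\mapsto st$ ($s\in S$); $S$ is viewed as a subset of $I_\ell(S)$, and $s^{-1}\in I_\ell(S)$ is the bijection $sS\to S$ inverse to $t\mapsto st$. $E(S)$ is the semigroup of idempotents of $I_\ell(S)$; each of them is the identity map $p_X$ on a constructible right ideal $X=s_1^{-1}t_1\dots s_n^{-1}t_nS$, and $\mathcal{J}(S)$ is the set of constructible right ideals. $\bar{\mathcal{J}}(S)$ is the collection of subsets of $S$ consisting of $\mathcal{J}(S)$ and all sets $X\setminus\bigcup_{i=1}^mX_i$ with $X,X_1,\dots,X_m\in\mathcal{J}(S)$. $S$ is finitely aligned if the right ideal $sS\cap tS$ is finitely generated for all $s,t\in S$. $S$ is strongly C$^*$-regular if, given $h_1,\dots,h_n\in I_\ell(S)$ and $X,X_1,\dots,X_m\in\mathcal{J}(S)$ satisfying $\emptyset\ne X\setminus\bigcup_{i=1}^mX_i\subset\bigcup_{k=1}^n\{s\in S:h_ks=s\}$, there are $Y_1,\dots,Y_l\in\mathcal{J}(S)$ and indices $1\le k_j\le n$ ($j=1,\dots,l$)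 such that $X\setminus\bigcup_{i=1}^mX_i\subset\bigcup_{j=1}^lY_j$ and $h_{k_j}p_{Y_j}=p_{Y_j}$ for all $1\le j\le l$. (Here $h_ks=s$ means that $s$ is in the domain of $h_k$ and is fixed by it.) Groupoids. $\widehat{E(S)}$ is the compact space (topology of pointwise convergence) of not identically zero semigroup homomorphisms $E(S)\to\{0,1\}$. For $s\in S$, $\chi_s(p_X)=1$ if $s\in X$ and $0$ otherwise. The Paterson groupoid $\mathcal{G}(I_\ell(S))$ is the set of classes $[g,\chi]$ of pairs $(g,\chi)\in I_\ell(S)\times\widehat{E(S)}$ with $\chi(g^{-1}g)=1$, where $(g_1,\chi_1)$, $(g_2,\chi_2)$ are equivalent iff $\chi_1=\chi_2$ and $g_1p=g_2p$ for some $p\in E(S)$ with $\chi_1(p)=1$. Product: $[g,\chi][h,\psi]=[gh,\psi]$ if $\chi=\psi(h^{-1}\cdot h)$; the unit space is identified with $\widehat{E(S)}$ via $\chi\mapsto[p_S,\chi]$; $s([g,\chi])=\chi$, $r([g,\chi])=\chi(g^{-1}\cdot g)$. A basis of the topology is given by the sets $D(g,U)=\{[g,\chi]:\chi\in U\}$, $U$ an open subset of $\{\chi:\chi(g^{-1}g)=1\}$. Let $\Omega(S)$ be the closure of $\{\chi_s:s\in S\}$ in $\widehat{E(S)}$ (an invariant set), and $\mathcal{G}_P(S)=\mathcal{G}(I_\ell(S))_{\Omega(S)}=r^{-1}(\Omega(S))=s^{-1}(\Omega(S))$ with the relative topology. Each $\chi\in\Omega(S)$ extends to $\bar{\mathcal{J}}(S)$: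 for $X,X_i\in\mathcal{J}(S)$, $\chi(p_{X\setminus\bigcup_iX_i})=1$ if $\chi(p_X)=1$ and $\chi(p_{X_i})=0$ for all $i$, and it is $0$ otherwise. Then $\mathcal{G}(S)=\mathcal{G}_P(S)/{\sim}$ is the quotient groupoid, where $[g,\chi]\sim[h,\chi]$ iff there is $X\in\bar{\mathcal{J}}(S)$ with $\chi(p_X)=1$ and $g|_X=h|_X$. The equality $\mathcal{G}_P(S)=\mathcal{G}(S)$ means that the relation $\sim$ is trivial. *)

theory Defs
  imports "HOL-Analysis.Analysis"
begin

text \<open>
  A monoid is a type of class \<open>monoid_mult\<close>. Partial maps are represented by their graphs,
  so \<open>p_X\<close> is \<open>Id_on X\<close>, the inverse of a partial bijection is its converse, and
  \<open>h s = s\<close> (with \<open>s\<close> in the domain of \<open>h\<close>) is \<open>(s, s) \<in> h\<close>.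
  Relational composition \<open>O\<close> is written in diagrammatic order, whence the swap below:
  \<open>g \<circ>\<^sub>p h\<close> applies \<open>h\<close> first.
\<close>

abbreviation pcomp :: "('b \<times> 'c) set \<Rightarrow> ('a \<times> 'b) set \<Rightarrow> ('a \<times> 'c) set"  (infixr "\<circ>\<^sub>p" 75)
  where "g \<circ>\<^sub>p h \<equiv> h O g"

definition ltrans :: "'a::monoid_mult \<Rightarrow> ('a \<times> 'a) set"
  where "ltrans s = {(t, s * t) | t. True}"

definition left_cancellative :: "'a::monoid_mult itself \<Rightarrow> bool"
  where "left_cancellative _ \<longleftrightarrow> (\<forall>s t u :: 'a. s * t = s * u \<longrightarrow> t = u)"

text \<open>The following notions are meaningful for left cancellative monoids only, as
  otherwise \<open>ltrans s\<close> need not be injective.\<close>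

inductive_set inverse_hull :: "('a::monoid_mult \<times> 'a) set set" where
  ltrans: "ltrans s \<in> inverse_hull"
| converse: "g \<in> inverse_hull \<Longrightarrow> g\<inverse> \<in> inverse_hull"
| comp: "g \<in> inverse_hull \<Longrightarrow> h \<in> inverse_hull \<Longrightarrow> g \<circ>\<^sub>p h \<in> inverse_hull"

definition idempotents :: "('a::monoid_mult \<times> 'a) set set"
  where "idempotents = {p \<in> inverse_hull. p \<circ>\<^sub>p p = p}"

text \<open>The sets \<open>s\<^sub>1\<inverse> t\<^sub>1 \<dots> s\<^sub>n\<inverse> t\<^sub>n S\<close>.\<close>

inductive_set constructible :: "'a::monoid_mult set set" where
  UNIV: "UNIV \<in> constructible"
| step: "X \<in> constructible \<Longrightarrow> (ltrans s)\<inverse> `` (ltrans t `` X) \<in> constructible"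

text \<open>The case \<open>F = {}\<close> gives the constructible ideals themselves.\<close>

definition constructible_diff :: "'a::monoid_mult set set"
  where "constructible_diff = {X - \<Union>F | X F. X \<in> constructible \<and> finite F \<and> F \<subseteq> constructible}"

definition principal_right_ideal :: "'a::monoid_mult \<Rightarrow> 'a set"
  where "principal_right_ideal s = range (\<lambda>t. s * t)"

text \<open>The empty right ideal counts as finitely generated.\<close>

definition fin_gen_right_ideal :: "'a::monoid_mult set \<Rightarrow> bool"
  where "fin_gen_right_ideal X \<longleftrightarrow> (\<exists>F. finite F \<and> X = (\<Union>f\<in>F. principal_right_ideal f))"

definition finitely_aligned :: "'a::monoid_mult itself \<Rightarrow> bool"
  where "finitely_aligned _ \<longleftrightarrow>
    (\<forall>s t :: 'a. fin_gen_right_ideal (principal_right_ideal s \<inter> principal_right_ideal t))"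

text \<open>The finite families \<open>h\<^sub>k\<close>, \<open>X\<^sub>i\<close>, \<open>Y\<^sub>j\<close> enter as the finite sets \<open>H\<close>, \<open>F\<close>, \<open>G\<close>; the indices
  \<open>k\<^sub>j\<close> become a choice of a member of \<open>H\<close> for every member of \<open>G\<close>.\<close>

definition strongly_C_star_regular :: "'a::monoid_mult itself \<Rightarrow> bool"
  where "strongly_C_star_regular _ \<longleftrightarrow>
    (\<forall>(H :: ('a \<times> 'a) set set) X F.
       finite H \<and> H \<subseteq> inverse_hull \<and> X \<in> constructible \<and> finite F \<and> F \<subseteq> constructible \<and>
       X - \<Union>F \<noteq> {} \<and> X - \<Union>F \<subseteq> (\<Union>h\<in>H. {s. (s, s) \<in> h}) \<longrightarrow>
       (\<exists>G. finite G \<and> G \<subseteq> constructible \<and> X - \<Union>F \<subseteq> \<Union>G \<and>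
            (\<forall>Y\<in>G. \<exists>h\<in>H. h \<circ>\<^sub>p Id_on Y = Id_on Y)))"

type_synonym 'a character = "('a \<times> 'a) set \<Rightarrow> nat"

text \<open>As elements of a product indexed by \<open>idempotents\<close>, characters are \<open>undefined\<close> outside it.\<close>

definition spectrum :: "'a::monoid_mult character set"
  where "spectrum = {\<phi> \<in> idempotents \<rightarrow>\<^sub>E {0, 1}.
           (\<forall>p\<in>idempotents. \<forall>q\<in>idempotents. \<phi> (p \<circ>\<^sub>p q) = \<phi> p * \<phi> q) \<and>
           (\<exists>p\<in>idempotents. \<phi> p \<noteq> 0)}"

definition spectrum_top :: "'a::monoid_mult character topology"
  where "spectrum_top =
    subtopology (product_topology (\<lambda>_. discrete_topology {0, 1}) idempotents) spectrum"

text \<open>If \<open>p = p_X\<close> then \<open>Domain p = X\<close>.\<close>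

definition point_char :: "'a::monoid_mult \<Rightarrow> 'a character"
  where "point_char s = (\<lambda>p\<in>idempotents. of_bool (s \<in> Domain p))"

definition Omega :: "'a::monoid_mult character set"
  where "Omega = spectrum_top closure_of (range point_char)"

definition char_ext :: "'a::monoid_mult character \<Rightarrow> 'a set \<Rightarrow> nat"
  where "char_ext \<phi> Z = of_bool
    (\<exists>X F. X \<in> constructible \<and> finite F \<and> F \<subseteq> constructible \<and> Z = X - \<Union>F \<and>
           \<phi> (Id_on X) = 1 \<and> (\<forall>Y\<in>F. \<phi> (Id_on Y) = 0))"

definition germ_pairs :: "(('a::monoid_mult \<times> 'a) set \<times> 'a character) set"
  where "germ_pairs = {(g, \<phi>). g \<in> inverse_hull \<and> \<phi> \<in> spectrum \<and> \<phi> (g\<inverse> \<circ>\<^sub>p g) = 1}"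

definition germ_rel ::
    "((('a::monoid_mult \<times> 'a) set \<times> 'a character) \<times> (('a \<times> 'a) set \<times> 'a character)) set"
  where "germ_rel = {((g\<^sub>1, \<phi>\<^sub>1), (g\<^sub>2, \<phi>\<^sub>2)).
           (g\<^sub>1, \<phi>\<^sub>1) \<in> germ_pairs \<and> (g\<^sub>2, \<phi>\<^sub>2) \<in> germ_pairs \<and> \<phi>\<^sub>1 = \<phi>\<^sub>2 \<and>
           (\<exists>p\<in>idempotents. \<phi>\<^sub>1 p = 1 \<and> g\<^sub>1 \<circ>\<^sub>p p = g\<^sub>2 \<circ>\<^sub>p p)}"

type_synonym 'a germ = "(('a \<times> 'a) set \<times> 'a character) set"

definition germ :: "('a::monoid_mult \<times> 'a) set \<Rightarrow> 'a character \<Rightarrow> 'a germ"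
  where "germ g \<phi> = germ_rel `` {(g, \<phi>)}"

definition basic_open :: "('a::monoid_mult \<times> 'a) set \<Rightarrow> 'a character set \<Rightarrow> 'a germ set"
  where "basic_open g U = germ g ` U"

text \<open>The generating sets form a basis, not just a subbasis.\<close>

definition Paterson_top :: "'a::monoid_mult germ topology"
  where "Paterson_top = topology_generated_by
    {basic_open g U | g U. g \<in> inverse_hull \<and> openin spectrum_top U \<and> U \<subseteq> {\<phi>. \<phi> (g\<inverse> \<circ>\<^sub>p g) = 1}}"

text \<open>The reduction of the Paterson groupoid to the invariant set \<open>Omega\<close>, i.e. the preimage of
  \<open>Omega\<close> under the source map \<open>[g, \<phi>] \<mapsto> \<phi>\<close>.\<close>

definition G_P :: "'a::monoid_mult germ set"
  where "G_P = {germ g \<phi> | g \<phi>. (g, \<phi>) \<in> germ_pairs \<and> \<phi> \<in> Omega}"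

definition G_P_top :: "'a::monoid_mult germ topology"
  where "G_P_top = subtopology Paterson_top G_P"

text \<open>The relation on \<open>G_P\<close> whose quotient is \<open>G\<close>; \<open>g \<circ>\<^sub>p Id_on Z\<close> is the restriction of \<open>g\<close> to \<open>Z\<close>.\<close>

definition G_rel :: "('a::monoid_mult germ \<times> 'a germ) set"
  where "G_rel = {(germ g \<phi>, germ h \<phi>) | g h \<phi>.
           (g, \<phi>) \<in> germ_pairs \<and> (h, \<phi>) \<in> germ_pairs \<and> \<phi> \<in> Omega \<and>
           (\<exists>Z\<in>constructible_diff. char_ext \<phi> Z = 1 \<and> g \<circ>\<^sub>p Id_on Z = h \<circ>\<^sub>p Id_on Z)}"

text \<open>The congruence on the free monoid of words generated by a set of pairs of words.\<close>

inductive pres_cong :: "('g list \<times> 'g list) set \<Rightarrow> 'g list \<Rightarrow> 'g list \<Rightarrow> bool"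
  for R where
  base: "(u, v) \<in> R \<Longrightarrow> pres_cong R u v"
| refl: "pres_cong R u u"
| sym: "pres_cong R u v \<Longrightarrow> pres_cong R v u"
| trans: "pres_cong R u v \<Longrightarrow> pres_cong R v w \<Longrightarrow> pres_cong R u w"
| append: "pres_cong R u v \<Longrightarrow> pres_cong R u' v' \<Longrightarrow> pres_cong R (u @ u') (v @ v')"

lemma equivp_pres_cong: "equivp (pres_cong R)"
  by (intro equivpI reflpI sympI transpI)
    (auto intro: pres_cong.refl pres_cong.sym pres_cong.trans)

datatype gen = GenA | GenB | GenX int | GenY int

definition defining_relations :: "(gen list \<times> gen list) set"
  where "defining_relations =
    {([GenA, GenB, GenX n], [GenB, GenX n]) | n. True} \<union>
    {([GenA, GenB, GenY n], [GenB, GenY (n + 1)]) | n. True}"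

quotient_type pres_monoid = "gen list" / "pres_cong defining_relations"
  by (rule equivp_pres_cong)

instantiation pres_monoid :: monoid_mult
begin

lift_definition one_pres_monoid :: pres_monoid is "[]" .

lift_definition times_pres_monoid :: "pres_monoid \<Rightarrow> pres_monoid \<Rightarrow> pres_monoid" is "(@)"
  by (rule pres_cong.append)

instance
  by standard (transfer; simp add: pres_cong.refl)+

end

end

theory Submission imports Defs begin

text \<open>
  The relations \<open>abx\<^sub>n \<rightarrow> bx\<^sub>n\<close>, \<open>aby\<^sub>n \<rightarrow> by\<^bsub>n+1\<^esub>\<close> have no overlaps, and letters act injectively on
  words, whence normal forms and left cancellation. Let \<open>D = \<Union>\<^sub>n (x\<^sub>nS \<union> y\<^sub>nS)\<close> and let \<open>\<sigma>\<close> be the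
  bijection of \<open>D\<close> fixing every \<open>x\<^sub>ns\<close> and sending \<open>y\<^sub>ns\<close> to \<open>y\<^bsub>n+1\<^esub>s\<close>. Since \<open>b\<inverse>a = \<sigma>b\<inverse>\<close>, the
  nonempty elements of the left inverse hull are \<open>uv\<inverse>\<close> and \<open>u\<sigma>\<^sup>kv\<inverse>\<close>, and the nonempty
  constructible ideals are \<open>vS\<close> and \<open>vD\<close>.

  If \<open>X - \<Union>F\<close> is nonempty and covered by the fixed point sets of finitely many \<open>h\<^sub>k\<close>, then one
  \<open>h\<^sub>k\<close> fixes all of \<open>X\<close>. For \<open>X = vS\<close> it is the one fixing \<open>v\<close>. For \<open>X = vD\<close> the set \<open>X - \<Union>F\<close>
  contains almost all \<open>vy\<^sub>n\<close>, so some \<open>h\<^sub>k\<close> fixes infinitely many of them, hence is \<open>u\<sigma>\<^sup>jv\<inverse>\<close>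
  on \<open>vD\<close>, and a single fixed \<open>vy\<^sub>n\<close> then determines \<open>h\<^sub>k\<close> to be the identity there. Strong
  regularity makes the relation defining the quotient of \<open>G_P\<close> trivial.

  The characters of the points \<open>x\<^sub>n\<close> converge to the character of the ideals containing \<open>D\<close>. The
  germs of \<open>\<sigma>\<close> and of the identity agree at each \<open>x\<^sub>n\<close>, but not at the limit, as \<open>\<sigma>\<close> moves \<open>y\<^sub>0\<close>.
\<close>

section \<open>Constructible ideals and the left inverse hull\<close>

no_notation pcompose (infixl "\<circ>\<^sub>p" 71)

lemma inverse_hull_bijective:
  assumes lc: "left_cancellative TYPE('a::monoid_mult)"
    and "(g :: ('a \<times> 'a) set) \<in> inverse_hull"
  shows "single_valued g \<and> single_valued (g\<inverse>)"
  using assms(2)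
proof induction
  case (ltrans s)
  then show ?case
    using lc by (auto simp: single_valued_def ltrans_def left_cancellative_def)
qed (auto simp: converse_relcomp intro: single_valued_relcomp)

lemma inverse_hull_functional:
  assumes "left_cancellative TYPE('a::monoid_mult)" "(g :: ('a \<times> 'a) set) \<in> inverse_hull"
    and "(s, t) \<in> g" "(s, t') \<in> g"
  shows "t = t'"
  using inverse_hull_bijective[OF assms(1,2)] assms(3,4) unfolding single_valued_def by blast

lemma inverse_hull_injective:
  assumes "left_cancellative TYPE('a::monoid_mult)" "(g :: ('a \<times> 'a) set) \<in> inverse_hull"
    and "(s, t) \<in> g" "(s', t) \<in> g"
  shows "s = s'"
  using inverse_hull_bijective[OF assms(1,2)] assms(3,4) unfolding single_valued_def by blast

text \<open>Left translations commute with right multiplications, and this property passes to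
  converses and composites. Consequently an element of the hull that fixes \<open>v\<close> fixes
  every multiple \<open>v * s\<close>.\<close>

lemma inverse_hull_right_mult:
  assumes "g \<in> inverse_hull" "(s, t) \<in> g"
  shows "(s * u, t * u) \<in> g"
  using assms
proof (induction arbitrary: s t)
  case (ltrans s)
  then show ?case by (auto simp: ltrans_def mult.assoc)
qed blast+

lemma mem_ltrans: "(t, r) \<in> ltrans s \<longleftrightarrow> r = s * t"
  by (auto simp: ltrans_def)

lemma ltrans_1: "ltrans 1 = Id"
  by (auto simp: ltrans_def)

lemma ltrans_mult: "ltrans (s * t) = ltrans s \<circ>\<^sub>p ltrans t"
  by (auto simp: ltrans_def mult.assoc)

lemma Id_mem_inverse_hull: "Id \<in> inverse_hull"
  using inverse_hull.ltrans[of 1] by (simp add: ltrans_1)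

lemma constructible_ltrans_image:
  assumes "X \<in> constructible"
  shows "ltrans s `` X \<in> constructible" "(ltrans s)\<inverse> `` X \<in> constructible"
  using constructible.step[OF assms, of 1 s] constructible.step[OF assms, of s 1]
  by (simp_all add: ltrans_1)

lemma constructible_right_mult:
  assumes "X \<in> constructible" "s \<in> X"
  shows "s * t \<in> X"
  using assms
proof (induction arbitrary: s)
  case (step X u v)
  then obtain r where "r \<in> X" "u * s = v * r" by (auto simp: ltrans_def)
  then have "r * t \<in> X" "u * (s * t) = v * (r * t)"
    using step.IH by (simp_all flip: mult.assoc)
  then show ?case by (auto simp: ltrans_def Image_iff)
qed simp

lemma constructible_hull_image:
  assumes "g \<in> inverse_hull" "X \<in> constructible"
  shows "g `` X \<in> constructible"
proof -
  \<comment> \<open>The claim is proved for \<open>g\<close> and its converse together, so that the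
    converse case of the induction is only a swap.\<close>
  have "\<forall>X\<in>constructible. g `` X \<in> constructible \<and> g\<inverse> `` X \<in> constructible"
    using assms(1)
    by induction
      (auto simp: constructible_ltrans_image converse_relcomp relcomp_Image)
  then show ?thesis using assms(2) by blast
qed

lemma constructible_Domain:
  assumes "g \<in> inverse_hull"
  shows "Domain g \<in> constructible"
proof -
  have "Domain g = g\<inverse> `` UNIV" by auto
  then show ?thesis
    using constructible_hull_image[OF inverse_hull.converse[OF assms] constructible.UNIV] by simp
qed

lemma converse_comp_self:
  assumes "left_cancellative TYPE('a::monoid_mult)" "(g :: ('a \<times> 'a) set) \<in> inverse_hull"
  shows "g\<inverse> \<circ>\<^sub>p g = Id_on (Domain g)"
proof -
  have "s = t" if "(s, r) \<in> g" "(t, r) \<in> g" for s r t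
    using that inverse_hull_injective[OF assms] by blast
  then show ?thesis by blast
qed

lemma comp_Id_on_fixed:
  assumes lc: "left_cancellative TYPE('a::monoid_mult)" and h: "h \<in> inverse_hull"
    and fixed: "\<And>s :: 'a. s \<in> X \<Longrightarrow> (s, s) \<in> h"
  shows "h \<circ>\<^sub>p Id_on X = Id_on X"
proof -
  have "s = t" if "s \<in> X" "(s, t) \<in> h" for s t
    using inverse_hull_functional[OF lc h fixed] that by blast
  then show ?thesis using fixed by blast
qed

lemma Id_on_mem_inverse_hull:
  assumes lc: "left_cancellative TYPE('a::monoid_mult)" and "(X :: 'a set) \<in> constructible"
  shows "Id_on X \<in> inverse_hull"
  using assms(2)
proof induction
  case UNIV
  have "Id_on UNIV = (Id :: ('a \<times> 'a) set)" by auto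
  then show ?case using Id_mem_inverse_hull by simp
next
  case (step X s t)
  \<comment> \<open>The domain of \<open>?g\<close> is exactly the ideal produced by
    \<open>step\<close>, and \<open>?g\<close> followed by its converse is the identity on that
    domain.\<close>
  let ?g = "Id_on X \<circ>\<^sub>p (ltrans t)\<inverse> \<circ>\<^sub>p ltrans s"
  have g: "?g \<in> inverse_hull"
    using step.IH by (intro inverse_hull.intros)
  have "Domain ?g = (ltrans s)\<inverse> `` (ltrans t `` X)" by auto
  with inverse_hull.comp[OF inverse_hull.converse[OF g] g] converse_comp_self[OF lc g]
  show ?case by simp
qed

text \<open>If \<open>p\<close> sends \<open>s\<close> to \<open>t\<close>, then
  \<open>p O p = p\<close> provides an intermediate point \<open>r\<close>. It equals
  \<open>t\<close> because \<open>p\<close> is functional and \<open>s\<close> because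
  \<open>p\<close> is injective.\<close>

lemma idempotent_eq_Id_on:
  assumes lc: "left_cancellative TYPE('a::monoid_mult)" and p: "(p :: ('a \<times> 'a) set) \<in> idempotents"
  shows "p = Id_on (Domain p)"
proof -
  have hull: "p \<in> inverse_hull" and idem: "p O p = p"
    using p unfolding idempotents_def by blast+
  have "s = t" if "(s, t) \<in> p" for s t
  proof -
    have "(s, t) \<in> p O p" using that idem by simp
    then obtain r where "(s, r) \<in> p" "(r, t) \<in> p" by blast
    with that inverse_hull_functional[OF lc hull, of s r t]
      inverse_hull_injective[OF lc hull, of s t r]
    show ?thesis by simp
  qed
  then show ?thesis by auto
qed

lemma Id_on_idempotent_iff:
  assumes lc: "left_cancellative TYPE('a::monoid_mult)"
  shows "Id_on X \<in> idempotents \<longleftrightarrow> (X :: 'a set) \<in> constructible"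
proof -
  have "Id_on X \<circ>\<^sub>p Id_on X = Id_on X" by auto
  moreover have "Id_on X \<in> inverse_hull \<Longrightarrow> X \<in> constructible"
    using constructible_Domain[of "Id_on X"] by simp
  ultimately show ?thesis
    using Id_on_mem_inverse_hull[OF lc] unfolding idempotents_def by blast
qed

lemma idempotents_eq:
  assumes lc: "left_cancellative TYPE('a::monoid_mult)"
  shows "(idempotents :: ('a \<times> 'a) set set) = Id_on ` constructible"
proof (intro subset_antisym subsetI)
  fix p :: "('a \<times> 'a) set" assume p: "p \<in> idempotents"
  then have "Domain p \<in> constructible"
    using constructible_Domain unfolding idempotents_def by blast
  with idempotent_eq_Id_on[OF lc p] show "p \<in> Id_on ` constructible"
    by (rule image_eqI[where x = "Domain p"])
qed (auto simp: Id_on_idempotent_iff[OF lc])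

lemma constructible_Int:
  assumes lc: "left_cancellative TYPE('a::monoid_mult)"
    and "(X :: 'a set) \<in> constructible" "Y \<in> constructible"
  shows "X \<inter> Y \<in> constructible"
proof -
  have "Id_on X `` Y = X \<inter> Y" by auto
  then show ?thesis
    using constructible_hull_image[OF Id_on_mem_inverse_hull[OF lc assms(2)] assms(3)] by simp
qed

section \<open>Characters and germs\<close>

lemma Id_on_comp: "Id_on X \<circ>\<^sub>p Id_on Y = Id_on (X \<inter> Y)"
  by auto

lemma spectrum_Id_on_Int:
  assumes lc: "left_cancellative TYPE('a::monoid_mult)" and "\<phi> \<in> spectrum"
    and "(X :: 'a set) \<in> constructible" "Y \<in> constructible"
  shows "\<phi> (Id_on (X \<inter> Y)) = \<phi> (Id_on X) * \<phi> (Id_on Y)"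
proof -
  have "Id_on X \<in> idempotents" "Id_on Y \<in> idempotents"
    using assms by (simp_all add: Id_on_idempotent_iff)
  then have "\<phi> (Id_on X \<circ>\<^sub>p Id_on Y) = \<phi> (Id_on X) * \<phi> (Id_on Y)"
    using assms(2) unfolding spectrum_def by blast
  then show ?thesis by (simp add: Id_on_comp)
qed

text \<open>The character of the filter of all constructible ideals containing \<open>A\<close>; it is
  \<open>\<chi>\<^sub>s\<close> for \<open>A = {s}\<close>.\<close>

lemma filter_char_mem_spectrum:
  assumes lc: "left_cancellative TYPE('a::monoid_mult)"
  shows "(\<lambda>p\<in>idempotents. of_bool (A \<subseteq> Domain p)) \<in> (spectrum :: 'a character set)"
proof -
  have *: "p \<circ>\<^sub>p q \<in> idempotents \<and> Domain (p \<circ>\<^sub>p q) = Domain p \<inter> Domain q"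
    if "p \<in> idempotents" "q \<in> idempotents" for p q :: "('a \<times> 'a) set"
    using that lc by (auto simp: idempotents_eq Id_on_comp constructible_Int)
  have "Id_on UNIV \<in> (idempotents :: ('a \<times> 'a) set set)"
    by (simp add: Id_on_idempotent_iff[OF lc] constructible.UNIV)
  then show ?thesis
    unfolding spectrum_def
    by (auto simp: * intro!: bexI[of _ "Id_on UNIV"])
qed

lemma point_char_mem_spectrum:
  assumes "left_cancellative TYPE('a::monoid_mult)"
  shows "point_char (s :: 'a) \<in> spectrum"
  using filter_char_mem_spectrum[OF assms, of "{s}"] by (simp add: point_char_def)

lemma point_char_Id_on:
  assumes "left_cancellative TYPE('a::monoid_mult)" "(X :: 'a set) \<in> constructible"
  shows "point_char s (Id_on X) = of_bool (s \<in> X)"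
  using assms by (simp add: point_char_def Id_on_idempotent_iff)

lemma topspace_spectrum_top: "topspace spectrum_top = spectrum"
  by (auto simp: spectrum_top_def spectrum_def)

lemma Omega_subset_spectrum: "Omega \<subseteq> spectrum"
  using closure_of_subset_topspace[of spectrum_top] by (simp add: Omega_def topspace_spectrum_top)

lemma point_char_mem_Omega:
  assumes "left_cancellative TYPE('a::monoid_mult)"
  shows "point_char (s :: 'a) \<in> Omega"
  unfolding Omega_def
  using closure_of_subset[of "range point_char" "spectrum_top :: 'a character topology"]
    point_char_mem_spectrum[OF assms]
  by (auto simp: topspace_spectrum_top)

text \<open>Prescribing the values of a character at finitely many idempotents defines an open set
  \<open>?U\<close>, and a point of the closure has some \<open>point_char s\<close> in each of its
  neighbourhoods. This replaces a character by a point of the monoid whenever only finitely many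
  ideals matter.\<close>

lemma Omega_approx_point_char:
  assumes "\<phi> \<in> Omega" "finite P" "P \<subseteq> idempotents"
  shows "\<exists>s. \<forall>p\<in>P. point_char s p = \<phi> p"
proof -
  have \<phi>: "\<phi> \<in> spectrum" using assms(1) Omega_subset_spectrum by blast
  let ?U = "(\<Pi>\<^sub>E p\<in>idempotents. if p \<in> P then {\<phi> p} else {0, 1 :: nat})"
  have ext: "\<phi> \<in> idempotents \<rightarrow>\<^sub>E {0, 1}" using \<phi> by (simp add: spectrum_def)
  then have val: "\<phi> p \<in> {0, 1}" if "p \<in> idempotents" for p
    using that by (rule PiE_mem)
  have "finite {p \<in> idempotents. (if p \<in> P then {\<phi> p} else {0, 1}) \<noteq> {0, 1 :: nat}}"
    by (rule finite_subset[OF _ assms(2)]) auto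
  then have "openin (product_topology (\<lambda>_. discrete_topology {0, 1}) idempotents) ?U"
    using val by (intro openin_PiE_gen[THEN iffD2] disjI2 conjI ballI) auto
  then have "openin spectrum_top (?U \<inter> spectrum)"
    unfolding spectrum_top_def by (rule openin_subtopology_Int)
  moreover have "\<phi> \<in> ?U \<inter> spectrum"
    using \<phi> ext by (simp add: PiE_iff)
  ultimately obtain s where s: "point_char s \<in> ?U"
    using assms(1) unfolding Omega_def in_closure_of by blast
  have "point_char s p = \<phi> p" if "p \<in> P" for p
  proof -
    have "point_char s p \<in> (if p \<in> P then {\<phi> p} else {0, 1})"
      by (rule PiE_mem[OF s]) (use that assms(3) in blast)
    with that show ?thesis by simp
  qed
  then show ?thesis by blast
qed

section \<open>Equality of germs, the quotient relation, and convergence of germs\<close>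

lemma germ_rel_iff:
  assumes lc: "left_cancellative TYPE('a::monoid_mult)"
  shows "((g, \<phi>), (h, \<psi> :: 'a character)) \<in> germ_rel \<longleftrightarrow>
    (g, \<phi>) \<in> germ_pairs \<and> (h, \<psi>) \<in> germ_pairs \<and> \<phi> = \<psi> \<and>
    (\<exists>X\<in>constructible. \<phi> (Id_on X) = 1 \<and> g \<circ>\<^sub>p Id_on X = h \<circ>\<^sub>p Id_on X)"
  unfolding germ_rel_def idempotents_eq[OF lc] by simp

text \<open>If \<open>X\<close> and \<open>Y\<close> witness the two equivalences, then
  \<open>X \<inter> Y\<close> witnesses the composite one; its value under \<open>\<phi>\<close> is
  \<open>1\<close> by multiplicativity.\<close>

lemma germ_rel_trans:
  assumes lc: "left_cancellative TYPE('a::monoid_mult)"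
    and gh: "((g, \<phi>), (h, \<phi>)) \<in> germ_rel" and hk: "((h, \<phi>), (k, \<phi> :: 'a character)) \<in> germ_rel"
  shows "((g, \<phi>), (k, \<phi>)) \<in> germ_rel"
proof -
  obtain X where X: "X \<in> constructible" "\<phi> (Id_on X) = 1" "g \<circ>\<^sub>p Id_on X = h \<circ>\<^sub>p Id_on X"
    using gh unfolding germ_rel_iff[OF lc] by blast
  obtain Y where Y: "Y \<in> constructible" "\<phi> (Id_on Y) = 1" "h \<circ>\<^sub>p Id_on Y = k \<circ>\<^sub>p Id_on Y"
    using hk unfolding germ_rel_iff[OF lc] by blast
  have "\<phi> \<in> spectrum" using gh by (auto simp: germ_rel_iff[OF lc] germ_pairs_def)
  then have "\<phi> (Id_on (X \<inter> Y)) = 1"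
    using X Y by (simp add: spectrum_Id_on_Int[OF lc])
  moreover have "g \<circ>\<^sub>p Id_on (X \<inter> Y) = k \<circ>\<^sub>p Id_on (X \<inter> Y)"
  proof -
    have "g \<circ>\<^sub>p Id_on (X \<inter> Y) = (g \<circ>\<^sub>p Id_on X) \<circ>\<^sub>p Id_on Y" by blast
    also have "\<dots> = (h \<circ>\<^sub>p Id_on Y) \<circ>\<^sub>p Id_on X" unfolding X(3) by blast
    also have "\<dots> = k \<circ>\<^sub>p Id_on (X \<inter> Y)" unfolding Y(3) by blast
    finally show ?thesis .
  qed
  moreover have "X \<inter> Y \<in> constructible"
    using X Y constructible_Int[OF lc] by blast
  ultimately show ?thesis
    using gh hk unfolding germ_rel_iff[OF lc] by blast
qed

lemma germ_rel_sym: "(a, b) \<in> germ_rel \<Longrightarrow> (b, a) \<in> germ_rel"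
  unfolding germ_rel_def by force

lemma germ_rel_refl:
  assumes lc: "left_cancellative TYPE('a::monoid_mult)" and gp: "(g, \<phi> :: 'a character) \<in> germ_pairs"
  shows "((g, \<phi>), (g, \<phi>)) \<in> germ_rel"
proof -
  have "\<phi> (Id_on (Domain g)) = 1" "Domain g \<in> constructible"
    using gp constructible_Domain[of g] by (auto simp: germ_pairs_def converse_comp_self[OF lc])
  then show ?thesis using gp unfolding germ_rel_iff[OF lc] by blast
qed

lemma germ_eq_iff:
  assumes lc: "left_cancellative TYPE('a::monoid_mult)"
    and gp: "(g, \<phi>) \<in> germ_pairs" and hp: "(h, \<psi> :: 'a character) \<in> germ_pairs"
  shows "germ g \<phi> = germ h \<psi> \<longleftrightarrow> ((g, \<phi>), (h, \<psi>)) \<in> germ_rel"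
proof
  show "((g, \<phi>), (h, \<psi>)) \<in> germ_rel" if "germ g \<phi> = germ h \<psi>"
    using that germ_rel_refl[OF lc hp] unfolding germ_def by blast
  have sub: "germ k \<theta> \<subseteq> germ k' \<theta>'" if "((k', \<theta>'), (k, \<theta>)) \<in> germ_rel" for k k' and \<theta> \<theta>' :: "'a character"
  proof
    fix c assume "c \<in> germ k \<theta>"
    then have "((k, \<theta>), c) \<in> germ_rel" by (simp add: germ_def)
    moreover have "\<theta> = \<theta>'" "snd c = \<theta>"
      using that calculation by (auto simp: germ_rel_def)
    ultimately show "c \<in> germ k' \<theta>'"
      using that germ_rel_trans[OF lc, of k' \<theta> k "fst c"] by (cases c) (simp add: germ_def)
  qed
  show "germ g \<phi> = germ h \<psi>" if "((g, \<phi>), (h, \<psi>)) \<in> germ_rel"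
    using sub[OF that] sub[OF germ_rel_sym[OF that]] by (rule equalityI[rotated])
qed

lemma germ_eqI:
  assumes lc: "left_cancellative TYPE('a::monoid_mult)"
    and "(g, \<phi>) \<in> germ_pairs" "(h, \<phi> :: 'a character) \<in> germ_pairs"
    and "X \<in> constructible" "\<phi> (Id_on X) = 1" "g \<circ>\<^sub>p Id_on X = h \<circ>\<^sub>p Id_on X"
  shows "germ g \<phi> = germ h \<phi>"
  unfolding germ_eq_iff[OF assms(1-3)] germ_rel_iff[OF lc] using assms(2-) by blast

text \<open>Where \<open>g\<close> and \<open>h\<close> agree,
  \<open>h\<inverse> \<circ>\<^sub>p g\<close> consists of fixed points. Regularity for this single
  element covers \<open>X' - \<Union>F\<close> by constructible ideals on each of which
  \<open>g\<close> and \<open>h\<close> agree, and \<open>\<phi>\<close> takes the value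
  \<open>1\<close> on one of these ideals.\<close>

lemma G_rel_imp_eq:
  assumes lc: "left_cancellative TYPE('a::monoid_mult)"
    and reg: "strongly_C_star_regular TYPE('a)"
    and rel: "(\<gamma>, \<delta> :: 'a germ) \<in> G_rel"
  shows "\<gamma> = \<delta>"
proof -
  obtain g h \<phi> Z where \<gamma>\<delta>: "\<gamma> = germ g \<phi>" "\<delta> = germ h \<phi>"
    and gp: "(g, \<phi>) \<in> germ_pairs" and hp: "(h, \<phi>) \<in> germ_pairs" and \<phi>\<Omega>: "\<phi> \<in> Omega"
    and Z1: "char_ext \<phi> Z = 1" and Z: "g \<circ>\<^sub>p Id_on Z = h \<circ>\<^sub>p Id_on Z"
    using rel by (auto simp: G_rel_def)
  obtain X F where X: "X \<in> constructible" and F: "finite F" "F \<subseteq> constructible"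
    and ZXF: "Z = X - \<Union>F" and \<phi>X: "\<phi> (Id_on X) = 1" and \<phi>F: "\<forall>Y\<in>F. \<phi> (Id_on Y) = 0"
    using Z1 unfolding char_ext_def of_bool_eq_1_iff by blast
  have g: "g \<in> inverse_hull" and h: "h \<in> inverse_hull" and \<phi>: "\<phi> \<in> spectrum"
    and "\<phi> (Id_on (Domain g)) = 1" "\<phi> (Id_on (Domain h)) = 1"
    using gp hp lc by (auto simp: germ_pairs_def converse_comp_self)
  \<comment> \<open>Passing to \<open>Domain g\<close> ensures that every point of
    \<open>X' - \<Union>F\<close> has an image under \<open>g\<close>, which is then also its image
    under \<open>h\<close>.\<close>
  define X' where "X' = X \<inter> Domain g"
  have X': "X' \<in> constructible"
    unfolding X'_def using X g by (intro constructible_Int[OF lc] constructible_Domain)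
  have \<phi>X': "\<phi> (Id_on X') = 1"
    unfolding X'_def using X g \<open>\<phi> (Id_on (Domain g)) = 1\<close> \<phi>X
    by (simp add: spectrum_Id_on_Int[OF lc \<phi>] constructible_Domain)
  \<comment> \<open>With \<open>G\<close> empty this gives that \<open>X' - \<Union>F\<close> is
    nonempty; later, with \<open>G\<close> the cover from regularity, it shows that some member of
    the cover has value \<open>1\<close> under \<open>\<phi>\<close>.\<close>
  have approx: "\<exists>s\<in>X' - \<Union>F. \<forall>Y\<in>G. s \<in> Y \<longleftrightarrow> \<phi> (Id_on Y) = 1"
    if G: "finite G" "G \<subseteq> constructible" for G
  proof -
    have "\<exists>s. \<forall>p\<in>Id_on ` insert X' (F \<union> G). point_char s p = \<phi> p"
      using X' F G by (intro Omega_approx_point_char[OF \<phi>\<Omega>]) (auto simp: idempotents_eq[OF lc])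
    then obtain s where "\<forall>Y\<in>insert X' (F \<union> G). point_char s (Id_on Y) = \<phi> (Id_on Y)"
      by auto
    then have "\<forall>Y\<in>insert X' (F \<union> G). of_bool (s \<in> Y) = \<phi> (Id_on Y)"
      using X' F G point_char_Id_on[OF lc] by (metis Un_iff insert_iff subsetD)
    then show ?thesis using \<phi>X' \<phi>F
      by (metis (no_types, lifting) DiffI UnI1 UnI2 UnionE insertI1 insertI2 of_bool_eq_0_iff
          of_bool_eq_1_iff zero_neq_one)
  qed
  have "X' - \<Union>F \<subseteq> (\<Union>k\<in>{h\<inverse> \<circ>\<^sub>p g}. {s. (s, s) \<in> k})"
  proof
    fix s assume s: "s \<in> X' - \<Union>F"
    then obtain t where t: "(s, t) \<in> g" by (auto simp: X'_def)
    moreover have "(s, t) \<in> g \<circ>\<^sub>p Id_on Z" using s t by (auto simp: X'_def ZXF)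
    then have "(s, t) \<in> h" unfolding Z by auto
    ultimately show "s \<in> (\<Union>k\<in>{h\<inverse> \<circ>\<^sub>p g}. {s. (s, s) \<in> k})" by auto
  qed
  moreover have "X' - \<Union>F \<noteq> {}" using approx[of "{}"] by auto
  moreover have "{h\<inverse> \<circ>\<^sub>p g} \<subseteq> inverse_hull" using g h by (auto intro: inverse_hull.intros)
  ultimately obtain G where G: "finite G" "G \<subseteq> constructible" "X' - \<Union>F \<subseteq> \<Union>G"
    and fix_G: "\<forall>Y\<in>G. \<exists>k\<in>{h\<inverse> \<circ>\<^sub>p g}. k \<circ>\<^sub>p Id_on Y = Id_on Y"
    using reg X' F unfolding strongly_C_star_regular_def
    by (metis (no_types, lifting) finite.emptyI finite.insertI)
  obtain s where "s \<in> X' - \<Union>F" "\<forall>Y\<in>G. s \<in> Y \<longleftrightarrow> \<phi> (Id_on Y) = 1"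
    using approx[OF G(1,2)] by blast
  then obtain Y where Y: "Y \<in> G" "\<phi> (Id_on Y) = 1" using G(3) by blast
  have fixed: "\<exists>t. (s, t) \<in> g \<and> (s, t) \<in> h" if "s \<in> Y" for s
  proof -
    have "(s, s) \<in> (h\<inverse> \<circ>\<^sub>p g) \<circ>\<^sub>p Id_on Y"
      using fix_G Y(1) that by auto
    then show ?thesis by auto
  qed
  have "g \<circ>\<^sub>p Id_on Y = h \<circ>\<^sub>p Id_on Y"
    using fixed inverse_hull_functional[OF lc g] inverse_hull_functional[OF lc h] by blast
  then show ?thesis
    unfolding \<gamma>\<delta> using germ_eqI[OF lc gp hp] Y G(2) by blast
qed

lemma G_rel_eq_Id_on:
  assumes lc: "left_cancellative TYPE('a::monoid_mult)"
    and reg: "strongly_C_star_regular TYPE('a)"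
  shows "(G_rel :: ('a germ \<times> 'a germ) set) = Id_on G_P"
proof
  show "G_rel \<subseteq> (Id_on G_P :: ('a germ \<times> 'a germ) set)"
  proof (rule subrelI)
    fix \<gamma> \<delta> :: "'a germ" assume rel: "(\<gamma>, \<delta>) \<in> G_rel"
    then have "\<gamma> \<in> G_P" by (auto simp: G_rel_def G_P_def)
    with G_rel_imp_eq[OF lc reg rel] show "(\<gamma>, \<delta>) \<in> Id_on G_P" by auto
  qed
  show "(Id_on G_P :: ('a germ \<times> 'a germ) set) \<subseteq> G_rel"
  proof
    fix c :: "'a germ \<times> 'a germ" assume "c \<in> Id_on G_P"
    then obtain g and \<phi> :: "'a character" where c: "c = (germ g \<phi>, germ g \<phi>)"
      and gp: "(g, \<phi>) \<in> germ_pairs" "\<phi> \<in> Omega"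
      by (auto simp: G_P_def)
    have dom: "Domain g \<in> constructible" "\<phi> (Id_on (Domain g)) = 1"
      using gp lc constructible_Domain by (auto simp: germ_pairs_def converse_comp_self)
    \<comment> \<open>Reflexivity is witnessed by \<open>Domain g\<close> itself, as a difference
      with the empty family removed.\<close>
    have diff: "Domain g = Domain g - \<Union>{}" by simp
    have "char_ext \<phi> (Domain g) = 1"
      unfolding char_ext_def of_bool_eq_1_iff using dom diff by (metis empty_iff empty_subsetI finite.emptyI)
    moreover have "Domain g \<in> constructible_diff"
      unfolding constructible_diff_def using dom diff by blast
    ultimately show "c \<in> G_rel" unfolding G_rel_def c using gp by blast
  qed
qed

text \<open>Convergence of characters lifts along \<open>g\<close>. If the limit germ lies in the
  basic set of \<open>h\<close> over \<open>U\<close>, then \<open>g\<close> and \<open>h\<close>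
  agree on an ideal \<open>X\<close> with \<open>\<phi> (Id_on X) = 1\<close>; eventually
  \<open>\<psi> n\<close> also has value \<open>1\<close> there and lies in \<open>U\<close>, so the
  germs of \<open>g\<close> and \<open>h\<close> at \<open>\<psi> n\<close> coincide. General open
  sets follow by induction on their generation.\<close>

lemma limitin_germ:
  assumes lc: "left_cancellative TYPE('a::monoid_mult)"
    and lim: "limitin spectrum_top \<psi> \<phi> F" and gp: "(g, \<phi> :: 'a character) \<in> germ_pairs"
    and ev: "\<forall>\<^sub>F n in F. (g, \<psi> n) \<in> germ_pairs"
  shows "limitin Paterson_top (\<lambda>n. germ g (\<psi> n)) (germ g \<phi>) F"
proof -
  let ?B = "{basic_open g U | g U. g \<in> inverse_hull \<and> openin spectrum_top U \<and>
    U \<subseteq> {\<phi> :: 'a character. \<phi> (g\<inverse> \<circ>\<^sub>p g) = 1}}"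
  have one: "\<forall>\<^sub>F n in F. \<psi> n p = 1" if "p \<in> idempotents" "\<phi> p = 1" for p
  proof -
    have "limitin (product_topology (\<lambda>_. discrete_topology {0, 1}) idempotents) \<psi> \<phi> F"
      using lim by (simp add: spectrum_top_def limitin_subtopology)
    then have "limitin (discrete_topology {0, 1}) (\<lambda>n. \<psi> n p) (\<phi> p) F"
      using that(1) by (simp add: limitin_componentwise)
    then show ?thesis using that(2) by (simp add: limitin_def)
        (metis (mono_tags, lifting) singletonI singletonD eventually_mono empty_subsetI insert_subset insertI1 insertI2)
  qed
  have "\<forall>\<^sub>F n in F. germ g (\<psi> n) \<in> W" if "generate_topology_on ?B W" "germ g \<phi> \<in> W" for W
    using that
  proof induction
    case (Int V W)
    then show ?case by (simp add: eventually_conj)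
  next
    case (UN K)
    then obtain W where "W \<in> K" "germ g \<phi> \<in> W" by blast
    with UN have "\<forall>\<^sub>F n in F. germ g (\<psi> n) \<in> W" by blast
    then show ?case using \<open>W \<in> K\<close> by (auto elim: eventually_mono)
  next
    case (Basis W)
    then obtain h U where W: "W = germ h ` U" and h: "h \<in> inverse_hull"
      and U: "openin spectrum_top U" "U \<subseteq> {\<phi>. \<phi> (h\<inverse> \<circ>\<^sub>p h) = 1}"
      by (auto simp: basic_open_def)
    have hp: "(h, \<phi>') \<in> germ_pairs" if "\<phi>' \<in> U" for \<phi>'
      using U h that openin_subset[OF U(1)] by (auto simp: germ_pairs_def topspace_spectrum_top)
    obtain \<phi>' where \<phi>': "\<phi>' \<in> U" "germ g \<phi> = germ h \<phi>'"
      using Basis W by blast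
    then have "((g, \<phi>), (h, \<phi>')) \<in> germ_rel"
      using germ_eq_iff[OF lc gp hp] by blast
    then obtain X where X: "X \<in> constructible" "\<phi> (Id_on X) = 1" "g \<circ>\<^sub>p Id_on X = h \<circ>\<^sub>p Id_on X"
      and "\<phi>' = \<phi>"
      unfolding germ_rel_iff[OF lc] by blast
    then have "\<forall>\<^sub>F n in F. \<psi> n \<in> U"
      using \<phi>' U(1) lim by (simp add: limitin_def)
    moreover have "\<forall>\<^sub>F n in F. \<psi> n (Id_on X) = 1"
      using one X Id_on_idempotent_iff[OF lc] by blast
    ultimately show ?case
      using ev
    proof eventually_elim
      case (elim n)
      then show ?case using germ_eqI[OF lc elim(3) hp X(1) elim(2) X(3)] W by blast
    qed
  qed auto
  \<comment> \<open>The space of a generated topology is the union of its generators, so a generator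
    containing the limit has to be exhibited: the one of \<open>g\<close> over all characters with
    value \<open>1\<close> at \<open>Id_on (Domain g)\<close>.\<close>
  moreover have "germ g \<phi> \<in> topspace Paterson_top"
  proof -
    have g: "g \<in> inverse_hull" "\<phi> \<in> spectrum" "\<phi> (g\<inverse> \<circ>\<^sub>p g) = 1"
      using gp by (auto simp: germ_pairs_def)
    let ?U = "{\<phi> \<in> topspace spectrum_top. \<phi> (Id_on (Domain g)) \<in> {1}}"
    have "continuous_map spectrum_top (discrete_topology {0, 1})
        (\<lambda>\<phi> :: 'a character. \<phi> (Id_on (Domain g)))"
      unfolding spectrum_top_def using constructible_Domain[OF g(1)]
      by (intro continuous_map_from_subtopology continuous_map_product_projection)
        (simp add: Id_on_idempotent_iff[OF lc])
    then have "openin spectrum_top ?U"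
      by (rule openin_continuous_map_preimage) auto
    moreover have "?U \<subseteq> {\<phi>. \<phi> (g\<inverse> \<circ>\<^sub>p g) = 1}"
      by (auto simp: converse_comp_self[OF lc g(1)])
    ultimately have "basic_open g ?U \<in> ?B"
      using g(1) by blast
    moreover have "germ g \<phi> \<in> basic_open g ?U"
      using g by (auto simp: basic_open_def topspace_spectrum_top converse_comp_self[OF lc])
    ultimately show ?thesis
      unfolding Paterson_top_def topology_generated_by_topspace by blast
  qed
  ultimately show ?thesis
    unfolding limitin_def Paterson_top_def openin_topology_generated_by_iff by blast
qed

section \<open>Normal forms\<close>

text \<open>Left multiplication by a letter in terms of normal forms. When \<open>w\<close> is
  normal, a rule can apply only at the front of \<open>p # w\<close>, and its result is again
  normal, so a single rewriting step suffices.\<close>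

fun act :: "gen \<Rightarrow> gen list \<Rightarrow> gen list" where
  "act GenA (GenB # GenX n # w) = GenB # GenX n # w"
| "act GenA (GenB # GenY n # w) = GenB # GenY (n + 1) # w"
| "act p w = p # w"

lemma act_neq_A [simp]: "p \<noteq> GenA \<Longrightarrow> act p w = p # w"
  by (cases p) auto

text \<open>Both sides of each defining relation act identically on all words, so the action
  descends to the monoid; this makes \<open>nf\<close> well defined.\<close>

lemma foldr_act_cong:
  assumes "pres_cong defining_relations u v"
  shows "foldr act u w = foldr act v w"
  using assms by (induction arbitrary: w) (auto simp: defining_relations_def)

lemma pres_cong_act: "pres_cong defining_relations (act p w) (p # w)"
proof (cases "(p, w)" rule: act.cases)
  case (1 n w)
  have "pres_cong defining_relations [GenA, GenB, GenX n] [GenB, GenX n]"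
    by (rule pres_cong.base) (auto simp: defining_relations_def)
  from pres_cong.append[OF pres_cong.sym[OF this] pres_cong.refl[of _ w]] 1
  show ?thesis by simp
next
  case (2 n w)
  have "pres_cong defining_relations [GenA, GenB, GenY n] [GenB, GenY (n + 1)]"
    by (rule pres_cong.base) (auto simp: defining_relations_def)
  from pres_cong.append[OF pres_cong.sym[OF this] pres_cong.refl[of _ w]] 2
  show ?thesis by simp
qed (auto intro: pres_cong.refl)

lemma pres_cong_foldr_act: "pres_cong defining_relations (foldr act u []) u"
proof (induction u)
  case (Cons p u)
  from pres_cong.append[OF pres_cong.refl[of _ "[p]"] this] show ?case
    using pres_cong.trans[OF pres_cong_act] by simp
qed (simp add: pres_cong.refl)

lift_definition nf :: "pres_monoid \<Rightarrow> gen list" is "\<lambda>u. foldr act u []"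
  by (rule foldr_act_cong)

lift_definition letter :: "gen \<Rightarrow> pres_monoid" is "\<lambda>p. [p]" .

lemma nf_1 [simp]: "nf 1 = []"
  by transfer simp

lemma nf_letter_mult [simp]: "nf (letter p * s) = act p (nf s)"
  by transfer simp

lemma nf_letter [simp]: "nf (letter p) = [p]"
  by transfer (cases p; simp)

lemma nf_eq_iff: "nf s = nf t \<longleftrightarrow> s = t"
proof
  show "s = t" if "nf s = nf t"
    using that by transfer (metis pres_cong.sym pres_cong.trans pres_cong_foldr_act)
qed simp

lemma pres_monoid_induct [case_names one letter]:
  assumes "P 1" "\<And>p s. P s \<Longrightarrow> P (letter p * s)"
  shows "P s"
proof -
  have "P (abs_pres_monoid w)" for w
  proof (induction w)
    case Nil
    then show ?case using assms(1) by (simp add: one_pres_monoid_def)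
  next
    case (Cons p w)
    then show ?case
      using assms(2)[of "abs_pres_monoid w" p]
      by (simp add: letter.abs_eq times_pres_monoid.abs_eq)
  qed
  then show ?thesis by (metis Quotient_pres_monoid Quotient_abs_rep)
qed

lemma pres_monoid_cases [case_names one letter]:
  obtains "s = 1" | p t where "s = letter p * t"
  by (induction s rule: pres_monoid_induct) auto

text \<open>For \<open>GenA\<close>, the three kinds of output begin with \<open>GenB\<close> and an
  x-letter, with \<open>GenB\<close> and a y-letter, and with \<open>GenA\<close>. They never
  collide, and each clause is injective. Left cancellation follows letter by letter.\<close>

lemma inj_act: "inj (act p)"
proof (rule injI)
  show "v = w" if "act p v = act p w" for v w
    using that by (cases "(p, v)" rule: act.cases; cases "(p, w)" rule: act.cases) auto
qed

lemma left_cancellative_pres_monoid: "left_cancellative TYPE(pres_monoid)"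
proof -
  have "t = u" if "s * t = s * u" for s t u :: pres_monoid
    using that
  proof (induction s rule: pres_monoid_induct)
    case (letter p s)
    then have "act p (nf (s * t)) = act p (nf (s * u))"
      by (metis mult.assoc nf_letter_mult)
    then show ?case using letter.IH by (metis injD inj_act nf_eq_iff)
  qed simp
  then show ?thesis by (simp add: left_cancellative_def)
qed

lemma mult_left_cancel_pres [simp]: "s * t = s * u \<longleftrightarrow> t = (u :: pres_monoid)"
  using left_cancellative_pres_monoid by (auto simp: left_cancellative_def)

lemma letter_mult_neq_1 [simp]: "letter p * s \<noteq> 1" "1 \<noteq> letter p * s"
proof -
  have "act p (nf s) \<noteq> []" by (cases "(p, nf s)" rule: act.cases) auto
  then show "letter p * s \<noteq> 1" by (metis nf_1 nf_letter_mult)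
  then show "1 \<noteq> letter p * s" by metis
qed

section \<open>Equations between products beginning with letters\<close>

fun shift :: "int \<Rightarrow> gen \<Rightarrow> gen" where
  "shift k (GenY n) = GenY (n + k)"
| "shift k p = p"

definition xy :: "gen set"
  where "xy = range GenX \<union> range GenY"

lemma GenX_xy [simp]: "GenX n \<in> xy" and GenY_xy [simp]: "GenY n \<in> xy"
  and GenA_xy [simp]: "GenA \<notin> xy" and GenB_xy [simp]: "GenB \<notin> xy"
  by (auto simp: xy_def)

lemma shift_shift [simp]: "shift k (shift j p) = shift (k + j) p"
  by (cases p) auto

lemma shift_0 [simp]: "shift 0 p = p"
  by (cases p) auto

lemma shift_xy [simp]: "shift k p \<in> xy \<longleftrightarrow> p \<in> xy"
  by (cases p) auto

lemma act_AB: "c \<in> xy \<Longrightarrow> act GenA (GenB # c # w) = GenB # shift 1 c # w"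
  by (cases c) auto

lemma AB_letter:
  assumes "c \<in> xy"
  shows "letter GenA * (letter GenB * (letter c * s)) = letter GenB * (letter (shift 1 c) * s)"
proof -
  have "\<exists>n. c = GenX n \<or> c = GenY n" using assms by (auto simp: xy_def)
  then show ?thesis by (auto simp flip: nf_eq_iff)
qed

lemma act_cases:
  obtains c v where "p = GenA" "c \<in> xy" "w = GenB # c # v" "act p w = GenB # shift 1 c # v"
  | "act p w = p # w"
proof (cases "(p, w)" rule: act.cases)
  case (1 n v)
  then show thesis using that(1)[of "GenX n" v] by simp
next
  case (2 n v)
  then show thesis using that(1)[of "GenY n" v] by simp
qed (use that(2) in auto)

text \<open>The tail of a normal form is normal: a rewriting step at the front would need
  \<open>p = GenA\<close> but would produce a word beginning with \<open>GenB\<close>.\<close>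

lemma nf_Cons_cases:
  assumes "nf s = p # w"
  obtains t where "s = letter p * t" "nf t = w"
proof -
  let ?t = "abs_pres_monoid w"
  have s: "s = letter p * ?t"
    using assms by (transfer) (metis append_Cons append_Nil pres_cong.sym pres_cong_foldr_act)
  then have "act p (nf ?t) = p # w" using assms by simp
  then have "nf ?t = w"
    by (cases "(p, nf ?t)" rule: act.cases) auto
  with s that show thesis by blast
qed

text \<open>The normal form of \<open>letter GenA * s\<close> can begin with \<open>GenB\<close>
  only if a rewriting rule was applied. This determines the intersection of the right ideals
  generated by the letters \<open>a\<close> and \<open>b\<close>.\<close>

lemma A_mult_eq_B_mult:
  "letter GenA * s = letter GenB * t \<longleftrightarrow>
   (\<exists>c\<in>xy. \<exists>r. s = letter GenB * (letter c * r) \<and> t = letter (shift 1 c) * r)" (is "?L \<longleftrightarrow> ?R")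
proof
  assume ?L
  then have *: "act GenA (nf s) = GenB # nf t" by (metis act_neq_A gen.distinct(1) nf_letter_mult)
  have "\<exists>c\<in>xy. \<exists>w. nf s = GenB # c # w"
    using * by (cases GenA "nf s" rule: act_cases) auto
  then obtain c w where c: "c \<in> xy" "nf s = GenB # c # w" by blast
  then obtain r where r: "s = letter GenB * (letter c * r)"
    by (metis nf_Cons_cases)
  with \<open>?L\<close> c AB_letter[of c r] have "t = letter (shift 1 c) * r" by simp
  with c r show ?R by blast
qed (auto simp: AB_letter)

lemma letter_mult_eq_iff:
  "letter p * s = letter q * t \<longleftrightarrow>
   p = q \<and> s = t \<or>
   p = GenA \<and> q = GenB \<and>
     (\<exists>c\<in>xy. \<exists>r. s = letter GenB * (letter c * r) \<and> t = letter (shift 1 c) * r) \<or>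
   p = GenB \<and> q = GenA \<and>
     (\<exists>c\<in>xy. \<exists>r. t = letter GenB * (letter c * r) \<and> s = letter (shift 1 c) * r)"
proof -
  have hd_act: "hd (act p' w) = p' \<or> p' = GenA \<and> hd (act p' w) = GenB" for p' w
    by (cases "(p', w)" rule: act.cases) auto
  consider "p = q" | "p = GenA" "q = GenB" | "p = GenB" "q = GenA"
    | "p \<noteq> q" "\<not> (p = GenA \<and> q = GenB)" "\<not> (p = GenB \<and> q = GenA)"
    by blast
  then show ?thesis
  proof cases
    case 1
    then show ?thesis by auto
  next
    case 2
    then show ?thesis by (simp add: A_mult_eq_B_mult)
  next
    case 3
    then show ?thesis
      by (simp add: A_mult_eq_B_mult eq_commute[of "letter GenB * s"])
  next
    case 4
    have "act p (nf s) \<noteq> act q (nf t)"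
    proof
      assume "act p (nf s) = act q (nf t)"
      then show False using 4 hd_act[of p "nf s"] hd_act[of q "nf t"] by auto
    qed
    then have "letter p * s \<noteq> letter q * t" by (metis nf_letter_mult)
    with 4 show ?thesis by blast
  qed
qed

lemma letter_xy_mult_eq_iff [simp]:
  assumes "c \<in> xy"
  shows "letter c * s = letter q * t \<longleftrightarrow> c = q \<and> s = t"
    and "letter q * t = letter c * s \<longleftrightarrow> q = c \<and> t = s"
proof -
  have "c \<noteq> GenA" "c \<noteq> GenB" using assms by auto
  then show "letter c * s = letter q * t \<longleftrightarrow> c = q \<and> s = t"
    "letter q * t = letter c * s \<longleftrightarrow> q = c \<and> t = s"
    unfolding letter_mult_eq_iff by blast+
qed

section \<open>The left inverse hull of the presented monoid\<close>

text \<open>The set \<open>b\<inverse> a S\<close>.\<close>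

definition D :: "pres_monoid set"
  where "D = {letter c * s | c s. c \<in> xy}"

text \<open>The partial bijection \<open>b\<inverse> a\<^sup>k b\<close>, for negative \<open>k\<close> the inverse of \<open>b\<inverse> a\<^bsup>-k\<^esup> b\<close>.\<close>

definition sigma :: "int \<Rightarrow> (pres_monoid \<times> pres_monoid) set"
  where "sigma k = {(letter c * s, letter (shift k c) * s) | c s. c \<in> xy}"

lemma Domain_sigma: "Domain (sigma k) = D"
  by (auto simp: sigma_def D_def)

lemma letter_D: "c \<in> xy \<Longrightarrow> letter c \<in> D"
  unfolding D_def by (metis (mono_tags, lifting) mem_Collect_eq mult.right_neutral)

lemma sigma_0: "sigma 0 = Id_on D"
  by (auto simp: sigma_def D_def)

lemma sigma_comp: "sigma j \<circ>\<^sub>p sigma k = sigma (j + k)"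
  by (force simp: sigma_def)

lemma sigma_converse: "(sigma k)\<inverse> = sigma (- k)"
proof -
  have "\<exists>d\<in>xy. c = shift (- k) d \<and> shift k c = d" if "c \<in> xy" for c
    using that by (intro bexI[of _ "shift k c"]) auto
  moreover have "\<exists>d\<in>xy. c = shift k d \<and> shift (- k) c = d" if "c \<in> xy" for c
    using that by (intro bexI[of _ "shift (- k) c"]) auto
  ultimately show ?thesis unfolding sigma_def by fastforce
qed

declare mem_ltrans [simp]

text \<open>Both sides send \<open>b c r\<close> to \<open>c' r\<close>, where
  \<open>c' = shift 1 c\<close>, and are undefined elsewhere. Together with its converse
  \<open>A_inv_B\<close>, this is the rule for moving an inverse letter past a different
  letter.\<close>

lemma B_inv_A: "(ltrans (letter GenB))\<inverse> \<circ>\<^sub>p ltrans (letter GenA) = sigma 1 \<circ>\<^sub>p (ltrans (letter GenB))\<inverse>"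
  by (auto simp: relcomp_unfold sigma_def A_mult_eq_B_mult)

lemma A_inv_B: "(ltrans (letter GenA))\<inverse> \<circ>\<^sub>p ltrans (letter GenB) = ltrans (letter GenB) \<circ>\<^sub>p sigma (- 1)"
  using B_inv_A[THEN arg_cong, of converse] by (simp add: converse_relcomp sigma_converse)

lemma sigma_1: "(ltrans (letter GenB))\<inverse> \<circ>\<^sub>p ltrans (letter GenA) \<circ>\<^sub>p ltrans (letter GenB) = sigma 1"
  by (auto simp: relcomp_unfold sigma_def A_mult_eq_B_mult)

lemma sigma_letter:
  "c \<in> xy \<Longrightarrow> sigma k \<circ>\<^sub>p ltrans (letter c) = ltrans (letter (shift k c))"
  "p \<notin> xy \<Longrightarrow> sigma k \<circ>\<^sub>p ltrans (letter p) = {}"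
  by (auto simp: relcomp_unfold sigma_def)

lemma letter_inv_letter:
  "(ltrans (letter p))\<inverse> \<circ>\<^sub>p ltrans (letter p) = Id"
  "\<lbrakk>p \<noteq> q; \<not> (p = GenA \<and> q = GenB); \<not> (p = GenB \<and> q = GenA)\<rbrakk> \<Longrightarrow>
    (ltrans (letter p))\<inverse> \<circ>\<^sub>p ltrans (letter q) = {}"
  by (auto simp: relcomp_unfold letter_mult_eq_iff)

section \<open>Closure of the sandwich forms \<open>u \<rho> v\<inverse>\<close> under
  composition\<close>

definition middle :: "(pres_monoid \<times> pres_monoid) set set"
  where "middle = insert Id (range sigma)"

definition sandwich :: "(pres_monoid \<times> pres_monoid) set set"
  where "sandwich = insert {} {ltrans u \<circ>\<^sub>p \<rho> \<circ>\<^sub>p (ltrans v)\<inverse> | u \<rho> v. \<rho> \<in> middle}"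

lemma sandwichI: "\<rho> \<in> middle \<Longrightarrow> ltrans u \<circ>\<^sub>p \<rho> \<circ>\<^sub>p (ltrans v)\<inverse> \<in> sandwich"
  by (auto simp: sandwich_def)

lemma sandwich_one_sidedI:
  "\<rho> \<in> middle \<Longrightarrow> ltrans u \<circ>\<^sub>p \<rho> \<in> sandwich"
  "\<rho> \<in> middle \<Longrightarrow> \<rho> \<circ>\<^sub>p (ltrans v)\<inverse> \<in> sandwich"
  using sandwichI[where v = 1] sandwichI[where u = 1] by (simp_all add: ltrans_1)

lemma sandwichE:
  assumes "h \<in> sandwich" "h \<noteq> {}"
  obtains u \<rho> v where "\<rho> \<in> middle" "h = ltrans u \<circ>\<^sub>p \<rho> \<circ>\<^sub>p (ltrans v)\<inverse>"
  using assms by (auto simp: sandwich_def)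

lemma middle_comp: "\<rho> \<in> middle \<Longrightarrow> \<tau> \<in> middle \<Longrightarrow> \<rho> \<circ>\<^sub>p \<tau> \<in> middle"
  by (auto simp: middle_def sigma_comp)

lemma sandwich_ltrans_comp:
  assumes "h \<in> sandwich"
  shows "ltrans s \<circ>\<^sub>p h \<in> sandwich"
proof (cases "h = {}")
  case False
  obtain u \<rho> v where "\<rho> \<in> middle" "h = ltrans u \<circ>\<^sub>p \<rho> \<circ>\<^sub>p (ltrans v)\<inverse>"
    using assms False by (elim sandwichE)
  then show ?thesis using sandwichI[of \<rho> v "s * u"] by (simp add: ltrans_mult O_assoc)
qed (simp add: sandwich_def)

lemma sandwich_comp_ltrans_inv:
  assumes "h \<in> sandwich"
  shows "h \<circ>\<^sub>p (ltrans s)\<inverse> \<in> sandwich"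
proof (cases "h = {}")
  case False
  obtain u \<rho> v where "\<rho> \<in> middle" "h = ltrans u \<circ>\<^sub>p \<rho> \<circ>\<^sub>p (ltrans v)\<inverse>"
    using assms False by (elim sandwichE)
  then show ?thesis
    using sandwichI[of \<rho> "s * v" u] by (simp add: ltrans_mult converse_relcomp O_assoc)
qed (simp add: sandwich_def)

text \<open>A trailing \<open>v\<inverse>\<close> is absorbed on the right, so left multiplication
  by \<open>g\<close> need only be tested on \<open>ltrans u \<circ>\<^sub>p \<rho>\<close>.\<close>

lemma sandwich_left_closed:
  assumes "h \<in> sandwich" "\<And>u \<rho>. \<rho> \<in> middle \<Longrightarrow> g \<circ>\<^sub>p ltrans u \<circ>\<^sub>p \<rho> \<in> sandwich"
  shows "g \<circ>\<^sub>p h \<in> sandwich"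
proof (cases "h = {}")
  case False
  obtain u \<rho> v where "\<rho> \<in> middle" "h = ltrans u \<circ>\<^sub>p \<rho> \<circ>\<^sub>p (ltrans v)\<inverse>"
    using assms(1) False by (elim sandwichE)
  then show ?thesis
    using sandwich_comp_ltrans_inv[OF assms(2)[of \<rho> u], of v] by (simp add: O_assoc)
qed (simp add: sandwich_def)

text \<open>If \<open>u\<close> is \<open>1\<close>, \<open>sigma k\<close> merges with the middle
  factor. Otherwise it relabels the first letter of \<open>u\<close>, or the product is empty
  because that letter is \<open>a\<close> or \<open>b\<close>.\<close>

lemma sandwich_sigma_comp:
  assumes "h \<in> sandwich"
  shows "sigma k \<circ>\<^sub>p h \<in> sandwich"
proof (rule sandwich_left_closed[OF assms])
  fix u \<rho> assume \<rho>: "\<rho> \<in> middle"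
  show "sigma k \<circ>\<^sub>p ltrans u \<circ>\<^sub>p \<rho> \<in> sandwich"
  proof (cases u rule: pres_monoid_cases)
    case one
    have "sigma k \<circ>\<^sub>p \<rho> \<in> middle"
      using \<rho> by (intro middle_comp) (simp_all add: middle_def)
    then show ?thesis using one sandwich_one_sidedI(1)[of _ 1] by (simp add: ltrans_1)
  next
    case (letter p t)
    show ?thesis
    proof (cases "p \<in> xy")
      case True
      have "sigma k \<circ>\<^sub>p ltrans u = ltrans (letter (shift k p) * t)"
        unfolding letter ltrans_mult sigma_letter(1)[OF True, symmetric] by (simp add: O_assoc)
      then show ?thesis using sandwich_one_sidedI(1)[OF \<rho>] by (simp add: O_assoc)
    next
      case False
      have "sigma k \<circ>\<^sub>p ltrans u = (sigma k \<circ>\<^sub>p ltrans (letter p)) \<circ>\<^sub>p ltrans t"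
        unfolding letter ltrans_mult by (simp add: O_assoc)
      then have "sigma k \<circ>\<^sub>p ltrans u = {}" by (simp add: sigma_letter(2)[OF False])
      then show ?thesis by (simp add: O_assoc sandwich_def)
    qed
  qed
qed

text \<open>The inverse letter meets the first letter \<open>q\<close> of \<open>u\<close>. It
  cancels, gives the empty map, disappears into a shift (\<open>A_inv_B\<close>), or survives behind
  a shift and moves on to the rest of \<open>u\<close> (\<open>B_inv_A\<close>), which is where the
  induction hypothesis enters.\<close>

lemma sandwich_letter_inv_comp:
  assumes "h \<in> sandwich"
  shows "(ltrans (letter p))\<inverse> \<circ>\<^sub>p h \<in> sandwich"
proof (rule sandwich_left_closed[OF assms])
  fix u \<rho> assume \<rho>: "\<rho> \<in> middle"
  show "(ltrans (letter p))\<inverse> \<circ>\<^sub>p ltrans u \<circ>\<^sub>p \<rho> \<in> sandwich"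
  proof (induction u rule: pres_monoid_induct)
    case one
    consider "\<rho> = Id" | k where "\<rho> = sigma k" using \<rho> by (auto simp: middle_def)
    then have "(ltrans (letter p))\<inverse> \<circ>\<^sub>p \<rho> \<in> sandwich"
    proof cases
      case 1
      then show ?thesis using sandwich_one_sidedI(2)[of Id "letter p"] by (simp add: middle_def)
    next
      case (2 k)
      \<comment> \<open>Taking converses reduces an inverse letter in front of
        \<open>sigma k\<close> to \<open>sigma (- k)\<close> in front of a letter.\<close>
      have eq: "(ltrans (letter p))\<inverse> \<circ>\<^sub>p \<rho> = (sigma (- k) \<circ>\<^sub>p ltrans (letter p))\<inverse>"
        unfolding 2 by (simp add: converse_relcomp sigma_converse)
      show ?thesis
      proof (cases "p \<in> xy")
        case True
        then show ?thesis using sandwich_one_sidedI(2)[of Id "letter (shift (- k) p)"]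
          unfolding eq by (simp add: sigma_letter middle_def)
      next
        case False
        then show ?thesis unfolding eq by (simp add: sigma_letter sandwich_def)
      qed
    qed
    then show ?case by (simp add: ltrans_1)
  next
    case (letter q t)
    have t: "ltrans t \<circ>\<^sub>p \<rho> \<in> sandwich" using sandwich_one_sidedI(1)[OF \<rho>] .
    have eq: "(ltrans (letter p))\<inverse> \<circ>\<^sub>p ltrans (letter q * t) \<circ>\<^sub>p \<rho>
      = ((ltrans (letter p))\<inverse> \<circ>\<^sub>p ltrans (letter q)) \<circ>\<^sub>p ltrans t \<circ>\<^sub>p \<rho>"
      by (simp add: ltrans_mult O_assoc)
    consider "p = q" | "p = GenA" "q = GenB" | "p = GenB" "q = GenA"
      | "p \<noteq> q" "\<not> (p = GenA \<and> q = GenB)" "\<not> (p = GenB \<and> q = GenA)"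
      by blast
    then show ?case
    proof cases
      case 1
      then show ?thesis unfolding eq using t by (simp add: letter_inv_letter)
    next
      case 2
      have "ltrans (letter GenB) \<circ>\<^sub>p sigma (- 1) \<circ>\<^sub>p ltrans t \<circ>\<^sub>p \<rho> \<in> sandwich"
        using sandwich_ltrans_comp[OF sandwich_sigma_comp[OF t]] .
      then show ?thesis unfolding eq unfolding 2 A_inv_B by (simp add: O_assoc)
    next
      case 3
      have "sigma 1 \<circ>\<^sub>p (ltrans (letter p))\<inverse> \<circ>\<^sub>p ltrans t \<circ>\<^sub>p \<rho> \<in> sandwich"
        using sandwich_sigma_comp[OF letter.IH] .
      then show ?thesis unfolding eq unfolding 3 B_inv_A by (simp add: O_assoc)
    next
      case 4
      then show ?thesis unfolding eq by (simp add: letter_inv_letter sandwich_def)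
    qed
  qed
qed

lemma sandwich_ltrans_inv_comp:
  assumes "h \<in> sandwich"
  shows "(ltrans s)\<inverse> \<circ>\<^sub>p h \<in> sandwich"
  using assms
proof (induction s arbitrary: h rule: pres_monoid_induct)
  case (letter p s)
  then show ?case
    using sandwich_letter_inv_comp by (simp add: ltrans_mult converse_relcomp flip: O_assoc)
qed (simp add: ltrans_1)

lemma sandwich_comp:
  assumes "g \<in> sandwich" "h \<in> sandwich"
  shows "g \<circ>\<^sub>p h \<in> sandwich"
proof (cases "g = {}")
  case False
  obtain u \<rho> v where \<rho>: "\<rho> \<in> middle" and g: "g = ltrans u \<circ>\<^sub>p \<rho> \<circ>\<^sub>p (ltrans v)\<inverse>"
    using assms(1) False by (elim sandwichE)
  have "\<rho> \<circ>\<^sub>p (ltrans v)\<inverse> \<circ>\<^sub>p h \<in> sandwich"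
    using \<rho> sandwich_ltrans_inv_comp[OF assms(2), of v] sandwich_sigma_comp
    by (auto simp: middle_def)
  from sandwich_ltrans_comp[OF this, of u] show ?thesis by (simp add: g O_assoc)
qed (simp add: sandwich_def)

lemma sandwich_converse:
  assumes "h \<in> sandwich"
  shows "h\<inverse> \<in> sandwich"
proof (cases "h = {}")
  case False
  obtain u \<rho> v where \<rho>: "\<rho> \<in> middle" and h: "h = ltrans u \<circ>\<^sub>p \<rho> \<circ>\<^sub>p (ltrans v)\<inverse>"
    using assms False by (elim sandwichE)
  have "\<rho>\<inverse> \<in> middle" using \<rho> by (auto simp: middle_def sigma_converse)
  then show ?thesis
    using sandwichI[of "\<rho>\<inverse>" u v] by (simp add: h converse_relcomp O_assoc)
qed (simp add: sandwich_def)

lemma inverse_hull_subset_sandwich: "inverse_hull \<subseteq> sandwich"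
proof
  fix g :: "(pres_monoid \<times> pres_monoid) set"
  assume "g \<in> inverse_hull"
  then show "g \<in> sandwich"
  proof induction
    case (ltrans s)
    show ?case using sandwich_one_sidedI(1)[of Id s] by (simp add: middle_def)
  qed (auto intro: sandwich_converse sandwich_comp)
qed

text \<open>\<open>X\<close> is the domain of \<open>Id_on X\<close>, which has a sandwich form. The
  trailing \<open>v\<inverse>\<close> and the domain of the middle factor determine this
  domain.\<close>

lemma constructible_pres_cases:
  assumes "X \<in> constructible"
  obtains "X = {}" | v where "X = range ((*) v)" | v where "X = (*) v ` D"
proof -
  have "Id_on X \<in> sandwich"
    using Id_on_mem_inverse_hull[OF left_cancellative_pres_monoid assms]
      inverse_hull_subset_sandwich by blast
  consider "Id_on X = {}" | u v where "Id_on X = ltrans u \<circ>\<^sub>p (ltrans v)\<inverse>"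
    | u v k where "Id_on X = ltrans u \<circ>\<^sub>p sigma k \<circ>\<^sub>p (ltrans v)\<inverse>"
    using \<open>Id_on X \<in> sandwich\<close> by (auto simp: sandwich_def middle_def)
  then show thesis
  proof cases
    case (2 u v)
    then have "X = Domain (ltrans u \<circ>\<^sub>p (ltrans v)\<inverse>)" by (metis Domain_Id_on)
    also have "\<dots> = range ((*) v)" by (auto simp: Domain_iff relcomp_unfold)
    finally show ?thesis by (rule that(2))
  next
    case (3 u v k)
    then have "X = Domain (ltrans u \<circ>\<^sub>p sigma k \<circ>\<^sub>p (ltrans v)\<inverse>)" by (metis Domain_Id_on)
    also have "\<dots> = (*) v ` Domain (sigma k)" by (fastforce simp: Domain_iff)
    finally show ?thesis using that(3) by (simp add: Domain_sigma)
  next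
    case 1
    then show ?thesis using that(1) by (metis Domain_Id_on Domain_empty)
  qed
qed

text \<open>The reason is that no constructible ideal contained in \<open>D\<close>, other than \<open>D\<close> itself,
  contains infinitely many of the letters \<open>c = x\<^sub>n, y\<^sub>n\<close>.\<close>

lemma inverse_hull_restrict_D:
  assumes h: "h \<in> inverse_hull" and inf: "infinite {c \<in> xy. v * letter c \<in> Domain h}"
  shows "\<exists>u k. h \<circ>\<^sub>p ltrans v \<circ>\<^sub>p sigma 0 = ltrans u \<circ>\<^sub>p sigma k"
proof -
  let ?g = "h \<circ>\<^sub>p ltrans v \<circ>\<^sub>p sigma 0"
  have "ltrans v \<circ>\<^sub>p sigma 0 \<in> sandwich"
    by (rule sandwich_one_sidedI(1)) (simp add: middle_def)
  then have "?g \<in> sandwich"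
    using h inverse_hull_subset_sandwich sandwich_comp[of h "ltrans v \<circ>\<^sub>p sigma 0"] by auto
  have dom: "letter c \<in> Domain ?g" if "c \<in> xy" "v * letter c \<in> Domain h" for c
  proof -
    have "(letter c, letter c) \<in> sigma 0"
      using that(1) by (auto simp: sigma_def intro!: exI[of _ c] exI[of _ 1])
    with that(2) show ?thesis by (fastforce simp: Domain_iff relcomp_unfold)
  qed
  then have "{c \<in> xy. v * letter c \<in> Domain h} \<subseteq> {c \<in> xy. letter c \<in> Domain ?g}"
    by blast
  then have inf': "infinite {c \<in> xy. letter c \<in> Domain ?g}"
    using inf infinite_super by blast
  then have "{c \<in> xy. letter c \<in> Domain ?g} \<noteq> {}" by (metis finite.emptyI)
  then have "?g \<noteq> {}" by auto
  obtain u \<rho> w where \<rho>: "\<rho> \<in> middle" and g: "?g = ltrans u \<circ>\<^sub>p \<rho> \<circ>\<^sub>p (ltrans w)\<inverse>"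
    using \<open>?g \<in> sandwich\<close> \<open>?g \<noteq> {}\<close> by (elim sandwichE)
  \<comment> \<open>If \<open>w\<close> began with a letter \<open>p\<close>, then \<open>p\<close>
    would be the only letter from \<open>xy\<close> that could lie in the domain of
    \<open>?g\<close>.\<close>
  have "w = 1"
  proof (cases w rule: pres_monoid_cases)
    case (letter p t)
    have "c = p" if c: "c \<in> xy" "letter c \<in> Domain ?g" for c
    proof -
      obtain s where "letter c = w * s" using c(2) unfolding g by auto
      then have "letter c * 1 = letter p * (t * s)" by (simp add: letter mult.assoc)
      then show ?thesis using c(1) letter_xy_mult_eq_iff(1) by blast
    qed
    then have "{c \<in> xy. letter c \<in> Domain ?g} \<subseteq> {p}" by blast
    then show ?thesis using inf' finite_subset by blast
  qed
  then have g': "?g = ltrans u \<circ>\<^sub>p \<rho>" by (simp add: g ltrans_1)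
  have "Domain ?g \<subseteq> D" using Domain_sigma[of 0] by blast
  moreover have "1 \<notin> D" by (auto simp: D_def)
  moreover have "1 \<in> Domain (ltrans u)" by auto
  \<comment> \<open>With \<open>\<rho> = Id\<close> the map would be defined at \<open>1\<close>,
    which is not in \<open>D\<close>.\<close>
  ultimately have "\<rho> \<noteq> Id" using g' by auto
  then show ?thesis using g' \<rho> unfolding middle_def by auto
qed

section \<open>Infinitely many fixed letters, and strong regularity\<close>

lemma infinite_xy:
  assumes "inj f" "range f \<subseteq> xy" "infinite {n. P (f n)}"
  shows "infinite {c \<in> xy. P c}"
proof
  assume "finite {c \<in> xy. P c}"
  then have "finite (f -` {c \<in> xy. P c})" using assms(1) by (rule finite_vimageI)
  moreover have "f -` {c \<in> xy. P c} = {n. P (f n)}" using assms(2) by auto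
  ultimately show False using assms(3) by simp
qed

lemma inverse_hull_restrict_D_apply:
  assumes "h \<circ>\<^sub>p ltrans v \<circ>\<^sub>p sigma 0 = ltrans u \<circ>\<^sub>p sigma k" "c \<in> xy"
  shows "(v * (letter c * s), u * (letter (shift k c) * s)) \<in> h"
proof -
  have "(letter c * s, letter (shift k c) * s) \<in> sigma k"
    using assms(2) by (auto simp: sigma_def)
  then have "(letter c * s, u * (letter (shift k c) * s)) \<in> h \<circ>\<^sub>p ltrans v \<circ>\<^sub>p sigma 0"
    unfolding assms(1) by auto
  then show ?thesis by (auto simp: sigma_0)
qed

lemma D_subset_if_infinite:
  assumes "h \<in> inverse_hull" "infinite {c \<in> xy. v * letter c \<in> Domain h}"
  shows "(*) v ` D \<subseteq> Domain h"
proof -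
  obtain u k where "h \<circ>\<^sub>p ltrans v \<circ>\<^sub>p sigma 0 = ltrans u \<circ>\<^sub>p sigma k"
    using inverse_hull_restrict_D[OF assms] by (elim exE)
  from inverse_hull_restrict_D_apply[OF this] show ?thesis
    unfolding D_def by blast
qed

text \<open>Multiplying by \<open>v\<close> one letter at a time, the final letter changes only when
  \<open>GenA\<close> meets the prefix \<open>[GenB]\<close>, and then by a shift whose amount does
  not depend on that letter. Hence \<open>w\<close> and \<open>k\<close> are uniform in
  \<open>c\<close>.\<close>

lemma nf_mult_letter:
  obtains w k where "\<And>c. c \<in> xy \<Longrightarrow> nf (v * letter c) = w @ [shift k c]"
proof -
  have "\<exists>w k. \<forall>c\<in>xy. nf (v * letter c) = w @ [shift k c]"
  proof (induction v rule: pres_monoid_induct)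
    case one
    show ?case by (auto intro!: exI[of _ "[]"] exI[of _ 0])
  next
    case (letter p v)
    then obtain w k where *: "\<forall>c\<in>xy. nf (v * letter c) = w @ [shift k c]" by blast
    \<comment> \<open>The rule acts on the final letter, inside the prefix, or not at all.\<close>
    consider "p = GenA" "w = [GenB]"
      | d w' where "p = GenA" "d \<in> xy" "w = GenB # d # w'"
      | "\<And>c. c \<in> xy \<Longrightarrow> act p (w @ [shift k c]) = p # w @ [shift k c]"
    proof (cases "p = GenA \<and> (\<exists>w'. w = GenB # w' \<and> (w' = [] \<or> hd w' \<in> xy))")
      case True
      then obtain w' where "p = GenA" "w = GenB # w'" "w' = [] \<or> hd w' \<in> xy" by blast
      then show thesis using that(1,2) by (cases w') auto
    next
      case False
      have "act p (w @ [shift k c]) = p # w @ [shift k c]" if "c \<in> xy" for c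
        using False by (cases p "w @ [shift k c]" rule: act_cases)
          (use that in \<open>auto simp: append_eq_Cons_conv\<close>)
      then show thesis using that(3) by blast
    qed
    then show ?case
    proof cases
      case 1
      then have "\<forall>c\<in>xy. nf (letter p * v * letter c) = [GenB] @ [shift (1 + k) c]"
        using * by (simp add: mult.assoc act_AB)
      then show ?thesis by blast
    next
      case (2 d w')
      then have "\<forall>c\<in>xy. nf (letter p * v * letter c) = (GenB # shift 1 d # w') @ [shift k c]"
        using * by (simp add: mult.assoc act_AB)
      then show ?thesis by blast
    next
      case 3
      then have "\<forall>c\<in>xy. nf (letter p * v * letter c) = (p # w) @ [shift k c]"
        using * by (simp add: mult.assoc)
      then show ?thesis by blast
    qed
  qed
  then show thesis using that by blast
qed

text \<open>Comparing normal forms at one y-letter gives equal prefixes and the relation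
  \<open>i = j + k\<close> between the shifts, which settles all letters. An x-letter could not
  serve here, since every shift fixes it.\<close>

lemma mult_letter_eq_transfer:
  assumes "v * letter (GenY n) = u * letter (shift k (GenY n))" "c \<in> xy"
  shows "v * letter c = u * letter (shift k c)"
proof -
  obtain w i where w: "\<And>c. c \<in> xy \<Longrightarrow> nf (v * letter c) = w @ [shift i c]"
    using nf_mult_letter[of v] by blast
  obtain w' j where w': "\<And>c. c \<in> xy \<Longrightarrow> nf (u * letter c) = w' @ [shift j c]"
    using nf_mult_letter[of u] by blast
  have "w @ [shift i (GenY n)] = w' @ [shift j (shift k (GenY n))]"
    using assms(1) w[of "GenY n"] w'[of "shift k (GenY n)"] by (simp del: shift.simps shift_shift)
  then have "w = w'" "i = j + k" by auto
  then have "nf (v * letter c) = nf (u * letter (shift k c))"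
    using w w' assms(2) by simp
  then show ?thesis by (simp add: nf_eq_iff)
qed

lemma fixes_D_if_infinite:
  assumes h: "h \<in> inverse_hull"
    and inf: "infinite {n. (v * letter (GenY n), v * letter (GenY n)) \<in> h}"
  shows "h \<circ>\<^sub>p Id_on ((*) v ` D) = Id_on ((*) v ` D)"
proof -
  have "infinite {n. v * letter (GenY n) \<in> Domain h}"
    by (rule infinite_super[OF _ inf]) blast
  then have "infinite {c \<in> xy. v * letter c \<in> Domain h}"
    by (rule infinite_xy[rotated 2]) (auto intro: injI)
  then obtain u k where uk: "h \<circ>\<^sub>p ltrans v \<circ>\<^sub>p sigma 0 = ltrans u \<circ>\<^sub>p sigma k"
    using inverse_hull_restrict_D[OF h] by meson
  obtain n where n: "(v * letter (GenY n), v * letter (GenY n)) \<in> h"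
    using inf not_finite_existsD by blast
  have "v * letter (GenY n) = u * letter (shift k (GenY n))"
    using inverse_hull_functional[OF left_cancellative_pres_monoid h n, of "u * letter (shift k (GenY n))"]
      inverse_hull_restrict_D_apply[OF uk, of "GenY n" 1] by simp
  note eq = mult_letter_eq_transfer[OF this]
  have "(v * s, v * s) \<in> h" if s: "s \<in> D" for s
  proof -
    obtain c r where "c \<in> xy" "s = letter c * r" using s by (auto simp: D_def)
    then show ?thesis
      using inverse_hull_restrict_D_apply[OF uk, of c r] eq[of c] by (simp flip: mult.assoc)
  qed
  then have "(s, s) \<in> h" if "s \<in> (*) v ` D" for s
    using that by blast
  then show ?thesis by (rule comp_Id_on_fixed[OF left_cancellative_pres_monoid h])
qed

lemma finite_GenY_in_constructible:
  assumes Y: "Y \<in> constructible" and "\<not> (*) v ` D \<subseteq> Y"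
  shows "finite {n. v * letter (GenY n) \<in> Y}"
proof (rule ccontr)
  assume inf: "infinite {n. v * letter (GenY n) \<in> Y}"
  then have "infinite {n. v * letter (GenY n) \<in> Domain (Id_on Y)}" by simp
  then have "infinite {c \<in> xy. v * letter c \<in> Domain (Id_on Y)}"
    by (rule infinite_xy[rotated 2]) (auto intro: injI)
  then have "(*) v ` D \<subseteq> Domain (Id_on Y)"
    by (rule D_subset_if_infinite[OF Id_on_mem_inverse_hull[OF left_cancellative_pres_monoid Y]])
  with assms(2) show False by simp
qed

text \<open>A single ideal suffices as cover, namely \<open>X\<close> itself: one member of
  \<open>H\<close> already fixes all of it.\<close>

lemma strongly_C_star_regular_pres_monoid: "strongly_C_star_regular TYPE(pres_monoid)"
proof -
  have "\<exists>h\<in>H. h \<circ>\<^sub>p Id_on X = Id_on X"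
    if H: "finite H" "H \<subseteq> inverse_hull" and X: "X \<in> constructible" and F: "finite F" "F \<subseteq> constructible"
      and ne: "X - \<Union>F \<noteq> {}" and cover: "X - \<Union>F \<subseteq> (\<Union>h\<in>H. {s. (s, s) \<in> h})"
    for H F and X :: "pres_monoid set"
    using X
  proof (cases X rule: constructible_pres_cases)
    case 1
    then show ?thesis using ne by simp
  next
    case (2 v)
    \<comment> \<open>A constructible ideal containing \<open>v\<close> contains all of
      \<open>X\<close>, so nonemptiness of the difference keeps the generator \<open>v\<close> in
      it.\<close>
    have "v \<in> X" using 2 by (metis mult.right_neutral rangeI)
    moreover have "v \<notin> Y" if "Y \<in> F" for Y
    proof
      assume "v \<in> Y"
      then have "X \<subseteq> Y" using constructible_right_mult F(2) that 2 by blast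
      then show False using ne that by blast
    qed
    ultimately have "v \<in> X - \<Union>F" by blast
    then have "v \<in> (\<Union>h\<in>H. {s. (s, s) \<in> h})" by (rule subsetD[OF cover])
    then obtain h where h: "h \<in> H" "(v, v) \<in> h" by (elim UN_E CollectE)
    then have hull: "h \<in> inverse_hull" using H(2) by blast
    have "(s, s) \<in> h" if "s \<in> X" for s
      using that inverse_hull_right_mult[OF hull h(2)] unfolding 2 by blast
    from comp_Id_on_fixed[OF left_cancellative_pres_monoid hull this] h(1) show ?thesis by (rule bexI)
  next
    case (3 v)
    have "finite {n. v * letter (GenY n) \<in> Y}" if "Y \<in> F" for Y
      using finite_GenY_in_constructible that F(2) ne 3 by blast
    then have fin: "finite (\<Union>Y\<in>F. {n. v * letter (GenY n) \<in> Y})"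
      by (rule finite_UN_I[OF F(1)])
    \<comment> \<open>Pigeonhole: the integers are covered by a finite set and the index sets of the
      fixed points of finitely many \<open>h\<close>, so one of these index sets is
      infinite.\<close>
    have "UNIV \<subseteq> (\<Union>Y\<in>F. {n. v * letter (GenY n) \<in> Y}) \<union>
      (\<Union>h\<in>H. {n. (v * letter (GenY n), v * letter (GenY n)) \<in> h})"
    proof
      fix n :: int
      have "letter (GenY n) \<in> D" by (simp add: letter_D)
      then have "v * letter (GenY n) \<in> X" unfolding 3 by (rule imageI)
      then consider "v * letter (GenY n) \<in> \<Union>F" | "v * letter (GenY n) \<in> X - \<Union>F" by blast
      then show "n \<in> (\<Union>Y\<in>F. {n. v * letter (GenY n) \<in> Y}) \<union>
          (\<Union>h\<in>H. {n. (v * letter (GenY n), v * letter (GenY n)) \<in> h})"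
      proof cases
        case 2
        then have "v * letter (GenY n) \<in> (\<Union>h\<in>H. {s. (s, s) \<in> h})" by (rule subsetD[OF cover])
        then show ?thesis by simp
      qed auto
    qed
    from infinite_super[OF this infinite_UNIV_int]
    have "infinite (\<Union>h\<in>H. {n. (v * letter (GenY n), v * letter (GenY n)) \<in> h})"
      using fin by simp
    then obtain h where h: "h \<in> H" "infinite {n. (v * letter (GenY n), v * letter (GenY n)) \<in> h}"
      using finite_UN_I[OF H(1)] by meson
    have "h \<circ>\<^sub>p Id_on X = Id_on X"
      unfolding 3 using h H(2) by (intro fixes_D_if_infinite) blast+
    then show ?thesis using h(1) by (rule bexI)
  qed
  note fixed = this
  show ?thesis
    unfolding strongly_C_star_regular_def
  proof (intro allI impI, elim conjE)
    fix H F and X :: "pres_monoid set"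
    assume "finite H" "H \<subseteq> inverse_hull" and X: "X \<in> constructible" and "finite F" "F \<subseteq> constructible"
      "X - \<Union>F \<noteq> {}" "X - \<Union>F \<subseteq> (\<Union>h\<in>H. {s. (s, s) \<in> h})"
    then have "\<exists>h\<in>H. h \<circ>\<^sub>p Id_on X = Id_on X" by (rule fixed)
    moreover have "X - \<Union>F \<subseteq> \<Union>{X}" by simp
    ultimately show "\<exists>G. finite G \<and> G \<subseteq> constructible \<and> X - \<Union>F \<subseteq> \<Union>G \<and>
        (\<forall>Y\<in>G. \<exists>h\<in>H. h \<circ>\<^sub>p Id_on Y = Id_on Y)"
      using X by (intro exI[of _ "{X}"]) simp
  qed
qed

text \<open>Any generator dividing \<open>b x_n\<close> lies in the intersection of the ideals of
  \<open>a\<close> and \<open>b\<close>, hence has the form \<open>b c r\<close> with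
  \<open>c\<close> in \<open>xy\<close>; comparison with \<open>b x_n\<close> forces
  \<open>c = x_n\<close>. Different \<open>n\<close> therefore need different generators.\<close>

lemma not_finitely_aligned_pres_monoid: "\<not> finitely_aligned TYPE(pres_monoid)"
proof
  let ?a = "letter GenA" and ?b = "letter GenB" and ?x = "\<lambda>n. letter (GenX n)"
  assume "finitely_aligned TYPE(pres_monoid)"
  then obtain F where F: "finite F"
    "principal_right_ideal ?a \<inter> principal_right_ideal ?b = (\<Union>f\<in>F. principal_right_ideal f)"
    unfolding finitely_aligned_def fin_gen_right_ideal_def by blast
  have "\<exists>f\<in>F. \<exists>r. f = ?b * (?x n * r)" for n
  proof -
    have "?b * ?x n = ?a * (?b * ?x n)" using AB_letter[of "GenX n" 1] by simp
    then have "?b * ?x n \<in> principal_right_ideal ?a \<inter> principal_right_ideal ?b"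
      unfolding principal_right_ideal_def by (metis IntI rangeI)
    then obtain f t where f: "f \<in> F" "?b * ?x n = f * t"
      unfolding F(2) by (auto simp: principal_right_ideal_def)
    have "f \<in> principal_right_ideal f"
      unfolding principal_right_ideal_def by (metis mult.right_neutral rangeI)
    then have "f \<in> principal_right_ideal ?a \<inter> principal_right_ideal ?b"
      unfolding F(2) using f(1) by (rule UN_I[rotated])
    then obtain s s' where s: "f = ?a * s" "f = ?b * s'"
      unfolding principal_right_ideal_def by (elim IntE rangeE)
    then have "?a * s = ?b * s'" by simp
    then obtain c r where "c \<in> xy" "s' = letter c * r"
      unfolding A_mult_eq_B_mult using shift_xy by blast
    with s(2) have fc: "f = ?b * (letter c * r)" by simp
    have "?x n * 1 = letter c * (r * t)" using f(2) unfolding fc by (simp add: mult.assoc)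
    then have "f = ?b * (?x n * r)"
      using letter_xy_mult_eq_iff(1)[of "GenX n" 1 c "r * t"] fc by simp
    then show ?thesis using f(1) by blast
  qed
  then have "\<forall>n. \<exists>f. f \<in> F \<and> (\<exists>r. f = ?b * (?x n * r))" by blast
  then obtain f where f: "\<And>n. f n \<in> F" "\<And>n. \<exists>r. f n = ?b * (?x n * r)"
    unfolding choice_iff by blast
  have "inj f"
  proof (rule injI)
    fix m n assume "f m = f n"
    then obtain r r' where "?b * (?x m * r) = ?b * (?x n * r')" using f(2) by metis
    then show "m = n" by simp
  qed
  then have "infinite (range f)" using finite_imageD infinite_UNIV_int by blast
  moreover have "range f \<subseteq> F" using f(1) by blast
  ultimately show False using F(1) finite_subset by blast
qed

section \<open>Failure of the Hausdorff property\<close>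

definition limit_char :: "pres_monoid character"
  where "limit_char = (\<lambda>p\<in>idempotents. of_bool (D \<subseteq> Domain p))"

lemma limit_char_mem_spectrum: "limit_char \<in> spectrum"
  unfolding limit_char_def by (rule filter_char_mem_spectrum[OF left_cancellative_pres_monoid])

text \<open>Convergence is checked at each idempotent. A constructible ideal containing
  \<open>D\<close> contains every \<open>x_n\<close>, and any other one contains only finitely many
  of them, by \<open>D_subset_if_infinite\<close>.\<close>

lemma limitin_limit_char:
  "limitin spectrum_top (\<lambda>n. point_char (letter (GenX (int n)))) limit_char sequentially"
proof -
  let ?\<psi> = "\<lambda>n. point_char (letter (GenX (int n)))"
  have spec: "?\<psi> n \<in> spectrum" for n
    by (rule point_char_mem_spectrum[OF left_cancellative_pres_monoid])
  have "\<forall>\<^sub>F n in sequentially. ?\<psi> n p = limit_char p" if p: "p \<in> idempotents" for p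
  proof (cases "D \<subseteq> Domain p")
    case True
    then have "letter (GenX n) \<in> Domain p" for n using letter_D[OF GenX_xy] by blast
    then show ?thesis using p True by (simp add: limit_char_def point_char_def)
  next
    case False
    have "p \<in> inverse_hull" using p by (simp add: idempotents_def)
    have "finite {n. letter (GenX (int n)) \<in> Domain p}"
    proof (rule ccontr)
      assume "infinite {n. letter (GenX (int n)) \<in> Domain p}"
      then have "infinite {n. 1 * letter (GenX (int n)) \<in> Domain p}" by simp
      then have "infinite {c \<in> xy. 1 * letter c \<in> Domain p}"
        by (rule infinite_xy[rotated 2]) (auto intro: injI)
      from D_subset_if_infinite[OF \<open>p \<in> inverse_hull\<close> this] False show False by auto
    qed
    then have "\<forall>\<^sub>F n in sequentially. letter (GenX (int n)) \<notin> Domain p"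
      by (simp add: eventually_cofinite flip: cofinite_eq_sequentially)
    then show ?thesis
      by (rule eventually_mono) (use False p in \<open>simp add: limit_char_def point_char_def\<close>)
  qed
  then have "limitin (discrete_topology {0, 1}) (\<lambda>n. ?\<psi> n p) (limit_char p) sequentially"
    if "p \<in> idempotents" for p
  proof -
    have "limit_char p \<in> {0, 1}" using that by (simp add: limit_char_def)
    with \<open>\<And>p. p \<in> idempotents \<Longrightarrow> \<forall>\<^sub>F n in sequentially. ?\<psi> n p = limit_char p\<close>[OF that]
    show ?thesis unfolding limitin_def by (auto elim: eventually_mono)
  qed
  moreover have "limit_char \<in> extensional idempotents" by (simp add: limit_char_def)
  moreover have "?\<psi> n \<in> topspace (product_topology (\<lambda>_. discrete_topology {0, 1}) idempotents)" for n
    using spec[of n] by (simp add: spectrum_def)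
  ultimately show ?thesis
    using spec limit_char_mem_spectrum
    by (simp add: spectrum_top_def limitin_subtopology limitin_componentwise)
qed

lemma limit_char_mem_Omega: "limit_char \<in> Omega"
  unfolding Omega_def in_closure_of
proof (intro conjI allI impI)
  show "limit_char \<in> topspace spectrum_top"
    by (simp add: topspace_spectrum_top limit_char_mem_spectrum)
  fix U assume "limit_char \<in> U \<and> openin spectrum_top U"
  then have "\<forall>\<^sub>F n in sequentially. point_char (letter (GenX (int n))) \<in> U"
    using limitin_limit_char by (auto simp: limitin_def)
  then have "\<exists>n. point_char (letter (GenX (int n))) \<in> U"
    by (rule eventually_happens'[OF sequentially_bot])
  then show "\<exists>\<psi>. \<psi> \<in> range point_char \<and> \<psi> \<in> U" by blast
qed

text \<open>The same sequence of germs converges to the germs of \<open>sigma 1\<close> and of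
  \<open>Id\<close> at \<open>limit_char\<close>, and these two limits differ.\<close>

lemma not_Hausdorff_G_P_top: "\<not> Hausdorff_space (G_P_top :: pres_monoid germ topology)"
proof
  assume haus: "Hausdorff_space (G_P_top :: pres_monoid germ topology)"
  let ?\<psi> = "\<lambda>n. point_char (letter (GenX (int n)))"
  note lc = left_cancellative_pres_monoid
  have hull: "sigma 1 \<in> inverse_hull" "Id \<in> (inverse_hull :: (pres_monoid \<times> pres_monoid) set set)"
    unfolding sigma_1[symmetric] by (intro inverse_hull.intros Id_mem_inverse_hull)+
  have pairs: "(g, limit_char) \<in> germ_pairs" "(g, ?\<psi> n) \<in> germ_pairs"
    if "g \<in> {sigma 1, Id}" for g n
  proof -
    have g: "g \<in> inverse_hull" "D \<subseteq> Domain g" using that hull Domain_sigma by auto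
    then show "(g, limit_char) \<in> germ_pairs"
      using limit_char_mem_spectrum constructible_Domain[of g]
      by (simp add: germ_pairs_def converse_comp_self[OF lc] limit_char_def Id_on_idempotent_iff[OF lc])
    show "(g, ?\<psi> n) \<in> germ_pairs"
      using g point_char_mem_spectrum[OF lc] constructible_Domain[of g] letter_D[of "GenX (int n)"]
      by (auto simp: germ_pairs_def converse_comp_self[OF lc] point_char_Id_on[OF lc])
  qed
  have G_P: "germ g limit_char \<in> G_P" "germ g (?\<psi> n) \<in> G_P" if "g \<in> {sigma 1, Id}" for g n
    using pairs[OF that] limit_char_mem_Omega point_char_mem_Omega[OF lc] unfolding G_P_def by blast+
  have lim: "limitin G_P_top (\<lambda>n. germ g (?\<psi> n)) (germ g limit_char) sequentially"
    if "g \<in> {sigma 1, Id}" for g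
    unfolding G_P_top_def limitin_subtopology
    using limitin_germ[OF lc limitin_limit_char pairs(1)[OF that]] pairs(2)[OF that] G_P[OF that]
    by simp
  have "germ (sigma 1) (?\<psi> n) = germ Id (?\<psi> n)" for n
  proof (rule germ_eqI[OF lc pairs(2) pairs(2)])
    \<comment> \<open>The ideal generated by \<open>x_n\<close> witnesses equality of the germs: it
      contains \<open>x_n\<close>, and \<open>sigma 1\<close> fixes it pointwise.\<close>
    let ?X = "range ((*) (letter (GenX (int n))))"
    have "?X = ltrans (letter (GenX (int n))) `` UNIV" by (auto simp: Image_def)
    then show X: "?X \<in> constructible"
      by (simp add: constructible_ltrans_image constructible.UNIV)
    have "letter (GenX (int n)) \<in> ?X" by (metis mult.right_neutral rangeI)
    then show "?\<psi> n (Id_on ?X) = 1" by (simp add: point_char_Id_on[OF lc X])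
    have "(letter (GenX (int n)) * s, t) \<in> sigma 1 \<longleftrightarrow> t = letter (GenX (int n)) * s" for s t
      by (auto simp: sigma_def)
    then show "sigma 1 \<circ>\<^sub>p Id_on ?X = Id \<circ>\<^sub>p Id_on ?X" by auto
  qed auto
  then have "limitin G_P_top (\<lambda>n. germ Id (?\<psi> n)) (germ (sigma 1) limit_char) sequentially"
    using lim[of "sigma 1"] by simp
  then have "germ (sigma 1) limit_char = germ Id limit_char"
    using lim[of Id] by (intro limitin_Hausdorff_unique[OF _ _ _ haus]) auto
  then have "((sigma 1, limit_char), (Id, limit_char)) \<in> germ_rel"
    by (subst germ_eq_iff[OF lc, symmetric]) (simp_all add: pairs(1))
  then obtain X where X: "X \<in> constructible" "limit_char (Id_on X) = 1"
    "sigma 1 \<circ>\<^sub>p Id_on X = Id \<circ>\<^sub>p Id_on X"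
    unfolding germ_rel_iff[OF lc] by (elim conjE bexE)
  have "limit_char (Id_on X) = of_bool (D \<subseteq> X)"
    using X(1) by (simp add: limit_char_def Id_on_idempotent_iff[OF lc])
  then have "D \<subseteq> X" using X(2) by (cases "D \<subseteq> X") simp_all
  \<comment> \<open>An ideal witnessing equality of the limit germs would contain \<open>D\<close>
    and hence \<open>y_0\<close>, which \<open>sigma 1\<close> moves to \<open>y_1\<close>. The
    factor \<open>1\<close> brings the letters into the form used by \<open>sigma\<close>.\<close>
  then have "letter (GenY 0) * 1 \<in> X" using letter_D[of "GenY 0"] by auto
  moreover have "(letter (GenY 0) * 1, letter (GenY 1) * 1) \<in> sigma 1"
    by (auto simp: sigma_def intro!: exI[of _ "GenY 0"] exI[of _ 1])
  ultimately have "(letter (GenY 0) * 1, letter (GenY 1) * 1) \<in> sigma 1 \<circ>\<^sub>p Id_on X" by blast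
  then have "letter (GenY 0) * 1 = letter (GenY 1) * 1"
    unfolding X(3) by (elim relcompE Id_onE IdE Pair_inject) metis
  then show False using letter_xy_mult_eq_iff(1)[OF GenY_xy, of 0 1 "GenY 1" 1] by simp
qed

theorem proposition3p1:
  "left_cancellative TYPE(pres_monoid) \<and>
   strongly_C_star_regular TYPE(pres_monoid) \<and>
   \<not> finitely_aligned TYPE(pres_monoid) \<and>
   (G_rel :: (pres_monoid germ \<times> pres_monoid germ) set) = Id_on G_P \<and>
   \<not> Hausdorff_space (G_P_top :: pres_monoid germ topology)"
  using left_cancellative_pres_monoid strongly_C_star_regular_pres_monoid
    not_finitely_aligned_pres_monoid not_Hausdorff_G_P_top G_rel_eq_Id_on by blast

end
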